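(* Consider the UCB1 allocation rule with $\gamma_T=\sqrt{2\log T}$. Fix $\eta_T>0$. For any $L>0$ and $K\in\mathbb N$ let $$\mathscr C(L)=\Big\{\Delta\in\mathbb R^K:\ \mathrm{supp}(\Delta)\subsetneq[K],\ \{\Delta_a/\sigma\}_{a:\Delta_a>0}\subset\big[L\sqrt{K\log T/T},\ \eta_T\sqrt{\log T}\big]\Big\},$$ and let $R^{\mathsf{LR}}(\Theta)=2\log T\cdot\sum_{a:\Delta_a>0}(\sigma^2/\Delta_a)$. Then there exists some universal constant $C>0$ such that for $K/T\le 1/C$, the following hold: (1) For any $L>C$, with $\epsilon_{T,K}=\sqrt{\log\log T/\log T}+K/T$, $$\sup_{\Delta\in\mathscr C(L)}\left|\frac{R(\Theta)}{R^{\mathsf{LR}}(\Theta)}-1\right|\le C\cdot\big(1/L+\epsilon_{T,K}+\eta_T\big).$$ (2) For any $\epsilon\in(0,1/2)$, $$\inf_{\Delta\in\mathscr C(\epsilon)}\frac{R(\Theta)}{R^{\mathsf{LR}}(\Theta)}\le C\cdot\epsilon^2.$$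
   Context: Bandit setup. Let $1\le K\le T$ be integers ($T\ge 3$, so that $\sqrt{\log\log T}$ is defined), $\mu_1,\dots,\mu_K\in\mathbb{R}$ arm means, $\sigma>0$, and $\gamma_T>0$ an exploration rate. Put $[n]=\{1,\dots,n\}$, $\mu_\ast=\max_{b\in[K]}\mu_b$, $\Delta_a=\mu_\ast-\mu_a\ge 0$ (sub-optimality gaps), $\Delta=(\Delta_a)_{a\in[K]}$, $\mathrm{supp}(\Delta)=\{a:\Delta_a\ne0\}$. All vectors $\Delta$ considered are gap vectors, so their entries are nonnegative. At each round $t\in[T]$ an arm $A_t\in[K]$ is chosen based on the past and a reward $R_t=\mu_{A_t}+\sigma\xi_t$ is observed, with $\xi_1,\dots,\xi_T$ i.i.d. $\mathcal N(0,1)$. Let $n_{a;t}=\sum_{s\in[t]}\mathbf 1\{A_s=a\}$ and $\hat\mu_{a;t}=n_{a;t}^{-1}\sum_{s\in[t]}R_s\mathbf 1\{A_s=a\}$. UCB1 algorithm with rate $\gamma_T$: pull each of the $K$ arms once in the first $K$ rounds; for $t=K+1,\dots,T$ choose $A_t\in\arg\max_{a\in[K]}\{\hat\mu_{a;t-1}+\sigma\gamma_T/\sqrt{n_{a;t-1}}\}$. Expected regret of UCB1: $R(\Theta)=\sum_{a:\Delta_a>0}\Delta_a\,\mathbb E\, n_{a;T}$, $\Theta=(T,K,\Delta,\sigma,\gamma_T)$; it depends on the means only through $\Delta$. The convention $0/0=0$ is used. "Universal constant" means independent of all parameters.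
   Formalization: In (1) the supremum omits Δ=0 (where 0/0=0 makes the deviation 1), and C may depend on an arbitrary fixed upper bound for η_T, since no universal C works for large η_T (K=2, Δ_2=η_Tσ√log T gives ratio at least η_T²/2); (2) holds for all η_T and also over nonzero Δ when there are any. *)

theory Defs
  imports "HOL-Probability.Probability"
begin

text \<open>
  Arms and rounds are indexed from 1. An allocation rule maps a round and the rewards observed
  before it to an arm; the arms pulled earlier are themselves determined by those rewards, so they
  need not be passed along. The rule does not see the means.
\<close>

type_synonym policy = "nat \<Rightarrow> (nat \<Rightarrow> real) \<Rightarrow> nat"

definition arm :: "policy \<Rightarrow> (nat \<Rightarrow> real) \<Rightarrow> nat \<Rightarrow> nat" where
  "arm \<pi> r t = \<pi> t (\<lambda>s\<in>{1..<t}. r s)"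

definition pulls :: "policy \<Rightarrow> (nat \<Rightarrow> real) \<Rightarrow> nat \<Rightarrow> nat \<Rightarrow> nat" where
  "pulls \<pi> r a t = card {s\<in>{1..t}. arm \<pi> r s = a}"

definition emp_mean :: "policy \<Rightarrow> (nat \<Rightarrow> real) \<Rightarrow> nat \<Rightarrow> nat \<Rightarrow> real" where
  "emp_mean \<pi> r a t = (\<Sum>s | s \<in> {1..t} \<and> arm \<pi> r s = a. r s) / real (pulls \<pi> r a t)"

definition ucb_index :: "real \<Rightarrow> real \<Rightarrow> policy \<Rightarrow> (nat \<Rightarrow> real) \<Rightarrow> nat \<Rightarrow> nat \<Rightarrow> real" where
  "ucb_index \<sigma> \<gamma> \<pi> r a t = emp_mean \<pi> r a t + \<sigma> * \<gamma> / sqrt (real (pulls \<pi> r a t))"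

text \<open>The order of the first \<open>K\<close> pulls and the resolution of ties are left to the rule.\<close>

definition is_ucb1 :: "nat \<Rightarrow> nat \<Rightarrow> real \<Rightarrow> real \<Rightarrow> policy \<Rightarrow> bool" where
  "is_ucb1 T K \<sigma> \<gamma> \<pi> \<longleftrightarrow>
     (\<forall>t\<in>{1..T}. \<pi> t \<in> measurable (Pi\<^sub>M {1..<t} (\<lambda>_. borel)) (count_space {1..K})) \<and>
     (\<forall>r. bij_betw (arm \<pi> r) {1..K} {1..K}) \<and>
     (\<forall>r. \<forall>t\<in>{K+1..T}.
        is_arg_max (\<lambda>a. ucb_index \<sigma> \<gamma> \<pi> r a (t - 1)) (\<lambda>a. a \<in> {1..K}) (arm \<pi> r t))"

definition noise :: "nat \<Rightarrow> (nat \<Rightarrow> real) measure" where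
  "noise T = Pi\<^sub>M {1..T} (\<lambda>_. std_normal_distribution)"

lemma restrict_fundef_cong [fundef_cong]:
  "I = J \<Longrightarrow> (\<And>i. i \<in> J \<Longrightarrow> f i = g i) \<Longrightarrow> restrict f I = restrict g J"
  by (rule restrict_cong) (auto simp: simp_implies_def)

fun rewards :: "policy \<Rightarrow> (nat \<Rightarrow> real) \<Rightarrow> real \<Rightarrow> (nat \<Rightarrow> real) \<Rightarrow> nat \<Rightarrow> real" where
  "rewards \<pi> \<mu> \<sigma> \<xi> t = \<mu> (\<pi> t (\<lambda>s\<in>{1..<t}. rewards \<pi> \<mu> \<sigma> \<xi> s)) + \<sigma> * \<xi> t"

declare rewards.simps [simp del]

definition gap :: "nat \<Rightarrow> (nat \<Rightarrow> real) \<Rightarrow> nat \<Rightarrow> real" where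
  "gap K \<mu> a = Max (\<mu> ` {1..K}) - \<mu> a"

definition regret :: "nat \<Rightarrow> nat \<Rightarrow> (nat \<Rightarrow> real) \<Rightarrow> real \<Rightarrow> policy \<Rightarrow> real" where
  "regret T K \<mu> \<sigma> \<pi> =
     (\<Sum>a | a \<in> {1..K} \<and> gap K \<mu> a > 0.
        gap K \<mu> a * (\<integral>\<xi>. real (pulls \<pi> (rewards \<pi> \<mu> \<sigma> \<xi>) a T) \<partial>noise T))"

definition regret_LR :: "nat \<Rightarrow> nat \<Rightarrow> (nat \<Rightarrow> real) \<Rightarrow> real \<Rightarrow> real" where
  "regret_LR T K \<Delta> \<sigma> = 2 * ln (real T) * (\<Sum>a | a \<in> {1..K} \<and> \<Delta> a > 0. \<sigma>\<^sup>2 / \<Delta> a)"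

text \<open>
  For a gap vector \<open>\<Delta>\<close> the mean vectors with these gaps are exactly \<open>\<lambda>a. m - \<Delta> a\<close>, where \<open>m\<close>
  is the best mean.
\<close>

definition regret_ratio ::
    "nat \<Rightarrow> nat \<Rightarrow> real \<Rightarrow> (nat \<Rightarrow> real) \<Rightarrow> real \<Rightarrow> policy \<Rightarrow> real" where
  "regret_ratio T K m \<Delta> \<sigma> \<pi> = regret T K (\<lambda>a. m - \<Delta> a) \<sigma> \<pi> / regret_LR T K \<Delta> \<sigma>"

definition gap_class :: "nat \<Rightarrow> nat \<Rightarrow> real \<Rightarrow> real \<Rightarrow> real \<Rightarrow> (nat \<Rightarrow> real) set" where
  "gap_class T K \<sigma> \<eta> L =
     {\<Delta> \<in> {1..K} \<rightarrow>\<^sub>E {0..}.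
        {a\<in>{1..K}. \<Delta> a \<noteq> 0} \<subset> {1..K} \<and>
        {\<Delta> a / \<sigma> | a. a \<in> {1..K} \<and> \<Delta> a > 0}
          \<subseteq> {L * sqrt (real K * ln (real T) / real T) .. \<eta> * sqrt (ln (real T))}}"

text \<open>
  The zero vector lies in every \<open>gap_class\<close>. There both regrets vanish and the ratio is
  \<open>0 / 0 = 0\<close>, so a two-sided comparison of the ratio with 1 is meaningful only away from it.
\<close>

definition gap_class_nz :: "nat \<Rightarrow> nat \<Rightarrow> real \<Rightarrow> real \<Rightarrow> real \<Rightarrow> (nat \<Rightarrow> real) set" where
  "gap_class_nz T K \<sigma> \<eta> L = {\<Delta> \<in> gap_class T K \<sigma> \<eta> L. \<exists>a\<in>{1..K}. \<Delta> a \<noteq> 0}"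

definition eps_TK :: "nat \<Rightarrow> nat \<Rightarrow> real" where
  "eps_TK T K = sqrt (ln (ln (real T)) / ln (real T)) + real K / real T"

end

(*
  In the adaptive model the noise collected by an arm, S, over its n pulls satisfies the maximal
  inequality P(l S - l^2 n / 2 >= c at some round) <= exp (- c), because the exponential of the left
  side is a martingale; this replaces any independence of the rewards of a fixed arm. Write
  d = Delta_a / sigma and gamma = sqrt (2 ln T), so the Lai-Robbins number of pulls is (gamma / d)^2.

  Upper bound: the index of a best arm stays above mu_* - theta Delta_a except on an event of
  probability O(1 / (T (gamma theta d)^2)), and an arm with more than (gamma / d)^2 / (1 - 2 theta)^2
  pulls then needs a deviation theta d of its mean to be chosen again.

  Lower bound: some arm has at least T / K pulls; at its last pull its index, which dominates that of
  a, is at most mu_* + O(Delta_a / L). Hence an arm a with fewer than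
  (1 - kappa)^2 (gamma / d)^2 / (1 + O(1 / L))^2 pulls has an exceptionally low mean, which a dyadic
  peeling over its number of pulls excludes.

  Both theta and kappa are of order sqrt (ln (ln T) / ln T). For the second part, all gaps but one are
  put at the left end of the allowed interval, where the trivial bound Delta T on the regret suffices.
*)
theory Submission
  imports Defs
begin

subsection \<open>An exponential maximal inequality for Gaussian noise\<close>

lemma sets_noise [measurable_cong]: "sets (noise T) = sets (Pi\<^sub>M {1..T} (\<lambda>_. borel))"
  unfolding noise_def by (intro sets_PiM_cong) auto

lemma prob_space_noise: "prob_space (noise T)"
  unfolding noise_def by (intro prob_space_PiM prob_space_normal_density) auto

text \<open>Completing the square turns the tilted standard normal density into the normal density
  with mean \<open>l\<close>, which has total mass one.\<close>

lemma nn_integral_std_normal_exp: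
  "(\<integral>\<^sup>+y. ennreal (exp (l * y - l\<^sup>2 / 2)) \<partial>std_normal_distribution) = 1"
proof -
  have "(\<integral>\<^sup>+y. ennreal (exp (l * y - l\<^sup>2 / 2)) \<partial>std_normal_distribution)
      = (\<integral>\<^sup>+y. ennreal (normal_density l 1 y) \<partial>lborel)"
  proof -
    have "std_normal_density y * exp (l * y - l\<^sup>2 / 2) = normal_density l 1 y" for y
      unfolding normal_density_def
      by (simp add: exp_add[symmetric] exp_diff[symmetric] power2_eq_square field_simps)
    then show ?thesis
      by (subst nn_integral_density) (auto simp: ennreal_mult'[symmetric] intro!: nn_integral_cong)
  qed
  also have "\<dots> = emeasure (density lborel (normal_density l 1)) UNIV"
    by (simp add: emeasure_density)
  also have "\<dots> = 1"
    using prob_space.emeasure_space_1[OF prob_space_normal_density[of 1 l]] by simp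
  finally show ?thesis .
qed

text \<open>The last coordinate is integrated out first: given the earlier noise, its factor has
  mean one. The second assumption expresses predictability: \<open>v s\<close> ignores the
  coordinates from \<open>s\<close> on.\<close>

lemma nn_integral_exp_martingale:
  fixes v :: "nat \<Rightarrow> (nat \<Rightarrow> real) \<Rightarrow> real"
  assumes "\<And>s. s \<in> {1..T} \<Longrightarrow> v s \<in> borel_measurable (Pi\<^sub>M {1..<s} (\<lambda>_. borel))"
    and "\<And>s \<xi>. s \<in> {1..T} \<Longrightarrow> v s (restrict \<xi> {1..<s}) = v s \<xi>"
  shows "(\<integral>\<^sup>+\<xi>. ennreal (exp (\<Sum>s\<in>{1..T}. v s \<xi> * \<xi> s - (v s \<xi>)\<^sup>2 / 2)) \<partial>noise T) = 1"
  using assms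
proof (induction T)
  case 0
  then show ?case
    using prob_space.emeasure_space_1[OF prob_space_noise[of 0]] by simp
next
  case (Suc T)
  let ?N = "std_normal_distribution"
  interpret product_sigma_finite "\<lambda>_::nat. ?N"
    by (intro product_sigma_finite.intro prob_space_imp_sigma_finite prob_space_normal_density) auto
  define X where "X n \<xi> = (\<Sum>s\<in>{1..n}. v s \<xi> * \<xi> s - (v s \<xi>)\<^sup>2 / 2)" for n \<xi>
  \<comment> \<open>Points of different product spaces are different extensional functions, so
    \<open>v s\<close> is read through \<open>restrict\<close> to make it measurable over any larger
    index set.\<close>
  have meas: "v s \<in> borel_measurable (Pi\<^sub>M I (\<lambda>_. borel))" if "s \<in> {1..Suc T}" "{1..<s} \<subseteq> I" for s I
  proof -
    have "(\<lambda>\<xi>. v s (restrict \<xi> {1..<s})) \<in> borel_measurable (Pi\<^sub>M I (\<lambda>_. borel))"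
      by (rule measurable_compose[OF measurable_restrict_subset[OF that(2)] Suc.prems(1)[OF that(1)]])
    then show ?thesis unfolding Suc.prems(2)[OF that(1)] .
  qed
  have upd: "v s (\<xi>(Suc T := y)) = v s \<xi>" if "s \<in> {1..Suc T}" for s \<xi> y
  proof -
    have "restrict (\<xi>(Suc T := y)) {1..<s} = restrict \<xi> {1..<s}"
      using that by (auto simp: restrict_def)
    then show ?thesis using Suc.prems(2)[OF that] by metis
  qed
  have Xm: "X (Suc T) \<in> borel_measurable (Pi\<^sub>M {1..Suc T} (\<lambda>_. borel))"
    unfolding X_def by (intro borel_measurable_sum borel_measurable_diff borel_measurable_times
        borel_measurable_divide borel_measurable_power borel_measurable_const meas measurable_component_singleton) auto
  have ins: "{1..Suc T} = insert (Suc T) {1..T}" by auto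
  have Xs: "X (Suc T) (\<xi>(Suc T := y)) = X T \<xi> + (v (Suc T) \<xi> * y - (v (Suc T) \<xi>)\<^sup>2 / 2)" for \<xi> y
    unfolding X_def ins using upd by (subst sum.insert) (auto intro!: sum.cong)
  have XmN: "X (Suc T) \<in> borel_measurable (Pi\<^sub>M (insert (Suc T) {1..T}) (\<lambda>_. ?N))"
    using Xm sets_noise[of "Suc T"] unfolding noise_def ins
    by (subst measurable_cong_sets) auto
  have "(\<integral>\<^sup>+\<xi>. ennreal (exp (X (Suc T) \<xi>)) \<partial>noise (Suc T))
     = (\<integral>\<^sup>+\<xi>. (\<integral>\<^sup>+y. ennreal (exp (X (Suc T) (\<xi>(Suc T := y)))) \<partial>?N) \<partial>noise T)"
    unfolding noise_def ins using XmN by (subst product_nn_integral_insert) auto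
  also have "\<dots> = (\<integral>\<^sup>+\<xi>. ennreal (exp (X T \<xi>)) *
      (\<integral>\<^sup>+y. ennreal (exp (v (Suc T) \<xi> * y - (v (Suc T) \<xi>)\<^sup>2 / 2)) \<partial>?N) \<partial>noise T)"
    by (simp add: Xs exp_add ennreal_mult' nn_integral_cmult del: fun_upd_apply)
  also have "\<dots> = 1"
    using Suc.IH[OF Suc.prems] by (simp add: nn_integral_std_normal_exp X_def)
  finally show ?case unfolding X_def .
qed

text \<open>Ville's inequality for the exponential martingale with predictable multipliers
  \<open>w\<close>. Measurability is asked over every index set containing the past, because the
  process is used both on the whole noise space and on the history before a round.\<close>

lemma exp_martingale_maximal:
  fixes w :: "nat \<Rightarrow> (nat \<Rightarrow> real) \<Rightarrow> real" and T :: nat and c :: real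
  defines "X \<equiv> \<lambda>t \<xi>. \<Sum>s\<in>{1..t}. w s \<xi> * \<xi> s - (w s \<xi>)\<^sup>2 / 2"
  assumes meas: "\<And>s I. s \<in> {1..T} \<Longrightarrow> {1..<s} \<subseteq> I \<Longrightarrow> w s \<in> borel_measurable (Pi\<^sub>M I (\<lambda>_. borel))"
    and pred: "\<And>s \<xi>. s \<in> {1..T} \<Longrightarrow> w s (restrict \<xi> {1..<s}) = w s \<xi>"
  shows "{\<xi> \<in> space (noise T). \<exists>t\<le>T. X t \<xi> \<ge> c} \<in> sets (noise T)"
    and "measure (noise T) {\<xi> \<in> space (noise T). \<exists>t\<le>T. X t \<xi> \<ge> c} \<le> exp (- c)"
proof -
  interpret prob_space "noise T" by (rule prob_space_noise)
  have Xm: "X t \<in> borel_measurable (Pi\<^sub>M I (\<lambda>_. borel))" if "t \<le> T" "{1..t} \<subseteq> I" for t I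
    unfolding X_def using that
    by (intro borel_measurable_sum borel_measurable_diff borel_measurable_times
        borel_measurable_divide borel_measurable_power borel_measurable_const meas measurable_component_singleton) auto
  have XmN[measurable]: "X t \<in> borel_measurable (noise T)" if "t \<le> T" for t
    using Xm[OF that, of "{1..T}"] that unfolding measurable_cong_sets[OF sets_noise refl] by auto
  let ?E = "{\<xi> \<in> space (noise T). \<exists>t\<le>T. X t \<xi> \<ge> c}"
  have "?E = (\<Union>t\<in>{..T}. {\<xi> \<in> space (noise T). c \<le> X t \<xi>})" by auto
  then show E: "?E \<in> sets (noise T)" using XmN by simp
  \<comment> \<open>The partial sums before round \<open>s\<close> see only earlier noise, which
    makes the stopping rule in \<open>v\<close> predictable.\<close>
  have Xp: "X u (restrict \<xi> {1..<s}) = X u \<xi>" if "s \<in> {1..T}" "u < s" for u s \<xi>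
    unfolding X_def
  proof (intro sum.cong refl)
    fix r assume r: "r \<in> {1..u}"
    have "restrict (restrict \<xi> {1..<s}) {1..<r} = restrict \<xi> {1..<r}"
      using r that by (auto simp: restrict_def)
    then have "w r (restrict \<xi> {1..<s}) = w r \<xi>"
      using pred[of r "restrict \<xi> {1..<s}"] pred[of r \<xi>] r that by auto
    then show "w r (restrict \<xi> {1..<s}) * restrict \<xi> {1..<s} r - (w r (restrict \<xi> {1..<s}))\<^sup>2 / 2 =
         w r \<xi> * \<xi> r - (w r \<xi>)\<^sup>2 / 2" using r that by auto
  qed
  \<comment> \<open>Freezing the process once it has reached \<open>c\<close> turns the maximal inequality into Markov's.\<close>
  define v where "v s \<xi> = (if \<forall>u\<in>{..<s}. X u \<xi> < c then w s \<xi> else 0)" for s \<xi>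
  define Y where "Y t \<xi> = (\<Sum>s\<in>{1..t}. v s \<xi> * \<xi> s - (v s \<xi>)\<^sup>2 / 2)" for t \<xi>
  have vm: "v s \<in> borel_measurable (Pi\<^sub>M {1..<s} (\<lambda>_. borel))" if "s \<in> {1..T}" for s
  proof -
    have [measurable]: "w s \<in> borel_measurable (Pi\<^sub>M {1..<s} (\<lambda>_. borel))" by (rule meas) (use that in auto)
    have [measurable]: "X u \<in> borel_measurable (Pi\<^sub>M {1..<s} (\<lambda>_. borel))" if "u \<in> {..<s}" for u
      by (rule Xm) (use that \<open>s \<in> {1..T}\<close> in auto)
    show ?thesis unfolding v_def by measurable
  qed
  have vp: "v s (restrict \<xi> {1..<s}) = v s \<xi>" if "s \<in> {1..T}" for s \<xi>
    unfolding v_def using Xp[OF that] pred[OF that] by auto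
  have int: "(\<integral>\<^sup>+\<xi>. ennreal (exp (Y T \<xi>)) \<partial>noise T) = 1"
    unfolding Y_def using vm vp by (rule nn_integral_exp_martingale[of T v])
  have YX: "Y t \<xi> = X t \<xi>" if "\<forall>u<t. X u \<xi> < c" for t \<xi>
    unfolding Y_def unfolding X_def using that
    by (intro sum.cong refl) (auto simp: v_def)
  have stop: "Y t \<xi> \<ge> c" if "\<exists>u\<le>t. X u \<xi> \<ge> c" for t \<xi>
    using that
  proof (induction t)
    case 0 then show ?case by (simp add: X_def Y_def)
  next
    case (Suc t)
    show ?case
    proof (cases "\<exists>u\<le>t. X u \<xi> \<ge> c")
      case True
      then have "\<not> (\<forall>u\<in>{..<Suc t}. X u \<xi> < c)" by (auto simp: not_less less_Suc_eq_le)
      then have "v (Suc t) \<xi> = 0" unfolding v_def by (rule if_not_P)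
      then have "Y (Suc t) \<xi> = Y t \<xi>" unfolding Y_def by simp
      then show ?thesis using Suc.IH[OF True] by simp
    next
      case False
      then have "\<forall>u<Suc t. X u \<xi> < c" by (meson less_Suc_eq_le not_le)
      then have "Y (Suc t) \<xi> = X (Suc t) \<xi>" by (rule YX)
      then show ?thesis using False Suc.prems by (auto simp: le_Suc_eq)
    qed
  qed
  have "emeasure (noise T) ?E = (\<integral>\<^sup>+\<xi>. indicator ?E \<xi> \<partial>noise T)" using E by simp
  also have "\<dots> \<le> (\<integral>\<^sup>+\<xi>. ennreal (exp (- c)) * ennreal (exp (Y T \<xi>)) \<partial>noise T)"
  proof (intro nn_integral_mono)
    fix \<xi>
    show "indicator ?E \<xi> \<le> ennreal (exp (- c)) * ennreal (exp (Y T \<xi>))"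
      using stop[of T \<xi>]
      by (auto simp: indicator_def ennreal_mult'[symmetric] exp_add[symmetric])
  qed
  also have "\<dots> = ennreal (exp (- c)) * (\<integral>\<^sup>+\<xi>. ennreal (exp (Y T \<xi>)) \<partial>noise T)"
  proof (intro nn_integral_cmult)
    have "v s \<in> borel_measurable (noise T)" if "s \<in> {1..T}" for s
    proof -
      have "(\<lambda>\<xi>. v s (restrict \<xi> {1..<s})) \<in> borel_measurable (Pi\<^sub>M {1..T} (\<lambda>_. borel))"
        by (rule measurable_compose[OF measurable_restrict_subset vm[OF that]]) (use that in auto)
      then show ?thesis using vp[OF that] unfolding measurable_cong_sets[OF sets_noise refl] by simp
    qed
    moreover have "(\<lambda>\<xi>. \<xi> s) \<in> borel_measurable (noise T)" if "s \<in> {1..T}" for s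
      unfolding measurable_cong_sets[OF sets_noise refl] using that by (rule measurable_component_singleton)
    ultimately have "Y T \<in> borel_measurable (noise T)"
      unfolding Y_def by (intro borel_measurable_sum borel_measurable_diff borel_measurable_times
        borel_measurable_divide borel_measurable_power borel_measurable_const) auto
    then show "(\<lambda>\<xi>. ennreal (exp (Y T \<xi>))) \<in> borel_measurable (noise T)" by measurable
  qed
  finally show "measure (noise T) ?E \<le> exp (- c)"
    unfolding int by (simp add: emeasure_eq_measure)
qed

subsection \<open>UCB1 as an adaptive process\<close>

locale ucb =
  fixes T K :: nat and \<sigma> \<gamma> m :: real and \<Delta> :: "nat \<Rightarrow> real" and \<pi> :: policy
  assumes K_le_T: "K \<le> T" and sigma_pos: "\<sigma> > 0" and ucb1: "is_ucb1 T K \<sigma> \<gamma> \<pi>"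
begin

sublocale prob_space "noise T" by (rule prob_space_noise)

definition rew :: "(nat \<Rightarrow> real) \<Rightarrow> nat \<Rightarrow> real" where
  "rew \<xi> = rewards \<pi> (\<lambda>a. m - \<Delta> a) \<sigma> \<xi>"

definition pulled :: "(nat \<Rightarrow> real) \<Rightarrow> nat \<Rightarrow> nat" where
  "pulled \<xi> t = arm \<pi> (rew \<xi>) t"

definition npulls :: "(nat \<Rightarrow> real) \<Rightarrow> nat \<Rightarrow> nat \<Rightarrow> nat" where
  "npulls \<xi> a t = card {s\<in>{1..t}. pulled \<xi> s = a}"

definition noise_sum :: "(nat \<Rightarrow> real) \<Rightarrow> nat \<Rightarrow> nat \<Rightarrow> real" where
  "noise_sum \<xi> a t = (\<Sum>s | s \<in> {1..t} \<and> pulled \<xi> s = a. \<xi> s)"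

text \<open>The UCB index after subtracting \<open>m\<close> and dividing by
  \<open>\<sigma>\<close>. This increasing affine change keeps the maximising arm, makes the noise
  standard and centres the best arms at 0.\<close>

definition index :: "(nat \<Rightarrow> real) \<Rightarrow> nat \<Rightarrow> nat \<Rightarrow> real" where
  "index \<xi> a t = noise_sum \<xi> a t / real (npulls \<xi> a t) + \<gamma> / sqrt (real (npulls \<xi> a t)) - \<Delta> a / \<sigma>"

lemma rew_eq: "rew \<xi> s = m - \<Delta> (pulled \<xi> s) + \<sigma> * \<xi> s"
proof -
  have "rew \<xi> s = m - \<Delta> (\<pi> s (\<lambda>u\<in>{1..<s}. rew \<xi> u)) + \<sigma> * \<xi> s"
    unfolding rew_def by (subst rewards.simps) simp
  then show ?thesis unfolding pulled_def arm_def .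
qed

lemma npulls_eq_pulls: "npulls \<xi> a t = pulls \<pi> (rew \<xi>) a t"
  by (simp add: npulls_def pulls_def pulled_def)

lemma ucb_index_eq:
  assumes "npulls \<xi> a t > 0"
  shows "ucb_index \<sigma> \<gamma> \<pi> (rew \<xi>) a t = m + \<sigma> * index \<xi> a t"
proof -
  have "(\<Sum>s | s \<in> {1..t} \<and> arm \<pi> (rew \<xi>) s = a. rew \<xi> s)
      = (\<Sum>s | s \<in> {1..t} \<and> pulled \<xi> s = a. (m - \<Delta> a) + \<sigma> * \<xi> s)"
    by (intro sum.cong) (auto simp: pulled_def rew_eq[unfolded pulled_def])
  also have "\<dots> = real (npulls \<xi> a t) * (m - \<Delta> a) + \<sigma> * noise_sum \<xi> a t"
    by (simp only: sum.distrib sum_distrib_left[symmetric] noise_sum_def npulls_def) simp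
  finally have "emp_mean \<pi> (rew \<xi>) a t = m - \<Delta> a + \<sigma> * noise_sum \<xi> a t / real (npulls \<xi> a t)"
    unfolding emp_mean_def npulls_eq_pulls[symmetric] using assms by (simp add: add_divide_distrib)
  then show ?thesis
    using sigma_pos unfolding ucb_index_def index_def npulls_eq_pulls[symmetric]
    by (simp add: distrib_left right_diff_distrib)
qed

text \<open>Strong induction, since the arm of round \<open>s\<close> is a function of all earlier
  rewards. This causality is what makes the choice of an arm predictable.\<close>

lemma rew_cong:
  assumes "\<And>u. u \<in> {1..s} \<Longrightarrow> \<xi> u = \<xi>' u" and "1 \<le> s"
  shows "rew \<xi> s = rew \<xi>' s"
  using assms
proof (induction s rule: less_induct)
  case (less s)
  have "(\<lambda>u\<in>{1..<s}. rew \<xi> u) = (\<lambda>u\<in>{1..<s}. rew \<xi>' u)"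
    by (rule restrict_ext) (rule less.IH; use less.prems in auto)
  then have "pulled \<xi> s = pulled \<xi>' s" unfolding pulled_def arm_def by simp
  then show ?case
    using less.prems unfolding rew_eq[of \<xi> s] rew_eq[of \<xi>' s] by simp
qed

lemma pulled_restrict: "pulled (restrict \<xi> {1..<s}) s = pulled \<xi> s"
proof -
  have "(\<lambda>u\<in>{1..<s}. rew (restrict \<xi> {1..<s}) u) = (\<lambda>u\<in>{1..<s}. rew \<xi> u)"
    by (rule restrict_ext) (rule rew_cong; auto)
  then show ?thesis by (simp add: pulled_def arm_def)
qed

lemma policy_measurable:
  "t \<in> {1..T} \<Longrightarrow> \<pi> t \<in> measurable (Pi\<^sub>M {1..<t} (\<lambda>_. borel)) (count_space {1..K})"
  using ucb1 by (simp add: is_ucb1_def)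

text \<open>Choices and rewards are mutually recursive; separating this half lets the induction in
  \<open>rew_measurable\<close> supply the measurability of the earlier rewards.\<close>

lemma pulled_measurable_if_rew:
  assumes "\<And>u. u \<in> {1..<s} \<Longrightarrow> (\<lambda>\<xi>. rew \<xi> u) \<in> borel_measurable M" and "s \<in> {1..T}"
  shows "(\<lambda>\<xi>. pulled \<xi> s) \<in> measurable M (count_space {1..K})"
proof -
  have "(\<lambda>\<xi>. \<lambda>u\<in>{1..<s}. rew \<xi> u) \<in> measurable M (Pi\<^sub>M {1..<s} (\<lambda>_. borel))"
    by (rule measurable_restrict) (rule assms)
  from measurable_compose[OF this policy_measurable[OF assms(2)]]
  show ?thesis by (simp add: pulled_def arm_def)
qed

lemma rew_measurable:
  assumes "s \<in> {1..T}" and "{1..s} \<subseteq> I"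
  shows "(\<lambda>\<xi>. rew \<xi> s) \<in> borel_measurable (Pi\<^sub>M I (\<lambda>_. borel))"
  using assms
proof (induction s rule: less_induct)
  case (less s)
  have "(\<lambda>\<xi>. pulled \<xi> s) \<in> measurable (Pi\<^sub>M I (\<lambda>_. borel)) (count_space {1..K})"
    using less.prems by (intro pulled_measurable_if_rew less.IH) auto
  then have "(\<lambda>\<xi>. m - \<Delta> (pulled \<xi> s)) \<in> borel_measurable (Pi\<^sub>M I (\<lambda>_. borel))"
    by (rule measurable_compose) simp
  moreover have "(\<lambda>\<xi>. \<xi> s) \<in> borel_measurable (Pi\<^sub>M I (\<lambda>_. borel))"
    using less.prems by (intro measurable_component_singleton) auto
  ultimately show ?case unfolding rew_eq by measurable
qed

lemma pulled_measurable:
  assumes "s \<in> {1..T}" and "{1..<s} \<subseteq> I"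
  shows "(\<lambda>\<xi>. pulled \<xi> s) \<in> measurable (Pi\<^sub>M I (\<lambda>_. borel)) (count_space {1..K})"
  using assms by (intro pulled_measurable_if_rew rew_measurable) auto

lemma pulled_in: "t \<in> {1..T} \<Longrightarrow> pulled \<xi> t \<in> {1..K}"
  using measurable_space[OF policy_measurable, of t "\<lambda>s\<in>{1..<t}. rew \<xi> s"]
  by (simp add: pulled_def arm_def space_PiM PiE_def)

lemma npulls_measurable: "(\<lambda>\<xi>. real (npulls \<xi> a T)) \<in> borel_measurable (noise T)"
proof -
  have eq: "real (npulls \<xi> a T) = (\<Sum>s\<in>{1..T}. indicator {a} (pulled \<xi> s))" for \<xi>
    unfolding npulls_def by (simp add: indicator_def sum.If_cases Int_def)
  have "(\<lambda>\<xi>. indicator {a} (pulled \<xi> s) :: real) \<in> borel_measurable (noise T)" if "s \<in> {1..T}" for s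
    unfolding measurable_cong_sets[OF sets_noise refl]
    by (rule measurable_compose[OF pulled_measurable]) (use that in auto)
  then show ?thesis unfolding eq by (rule borel_measurable_sum)
qed

text \<open>The event that the exponential martingale of slope \<open>l\<close> along the pulls of
  \<open>a\<close> reaches exp c at some round. Positive \<open>l\<close> detects upward and
  negative \<open>l\<close> downward deviations.\<close>

definition dev :: "nat \<Rightarrow> real \<Rightarrow> real \<Rightarrow> (nat \<Rightarrow> real) set" where
  "dev a l c = {\<xi> \<in> space (noise T).
     \<exists>t\<le>T. l * noise_sum \<xi> a t - l\<^sup>2 * real (npulls \<xi> a t) / 2 \<ge> c}"

text \<open>The multiplier is \<open>l\<close> in the rounds that pull \<open>a\<close> and 0
  elsewhere. It is predictable because an arm is chosen before the noise of its round is
  seen.\<close>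

lemma dev_sets [measurable]: "dev a l c \<in> sets (noise T)"
  and prob_dev: "prob (dev a l c) \<le> exp (- c)"
proof -
  define w where "w s \<xi> = (if pulled \<xi> s = a then l else 0)" for s \<xi>
  have eq: "(\<Sum>s\<in>{1..t}. w s \<xi> * \<xi> s - (w s \<xi>)\<^sup>2 / 2)
      = l * noise_sum \<xi> a t - l\<^sup>2 * real (npulls \<xi> a t) / 2" for t \<xi>
  proof -
    have "(\<Sum>s\<in>{1..t}. w s \<xi> * \<xi> s - (w s \<xi>)\<^sup>2 / 2)
        = (\<Sum>s\<in>{1..t}. if pulled \<xi> s = a then l * \<xi> s - l\<^sup>2 / 2 else 0)"
      by (intro sum.cong) (auto simp: w_def)
    also have "\<dots> = (\<Sum>s | s \<in> {1..t} \<and> pulled \<xi> s = a. l * \<xi> s - l\<^sup>2 / 2)"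
      by (simp add: sum.If_cases Int_def)
    also have "\<dots> = l * noise_sum \<xi> a t - l\<^sup>2 * real (npulls \<xi> a t) / 2"
      by (simp only: sum_subtractf sum_distrib_left[symmetric] noise_sum_def npulls_def) simp
    finally show ?thesis .
  qed
  have wm: "w s \<in> borel_measurable (Pi\<^sub>M I (\<lambda>_. borel))" if "s \<in> {1..T}" "{1..<s} \<subseteq> I" for s I
    unfolding w_def by (rule measurable_compose[OF pulled_measurable[OF that]]) simp
  have wp: "w s (restrict \<xi> {1..<s}) = w s \<xi>" for s \<xi>
    unfolding w_def pulled_restrict ..
  note max = exp_martingale_maximal[of T w c, unfolded eq, folded dev_def]
  show "dev a l c \<in> sets (noise T)"
    by (rule max(1)) (erule (1) wm, rule wp)
  show "prob (dev a l c) \<le> exp (- c)"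
    by (rule max(2)) (erule (1) wm, rule wp)
qed

lemma not_devD:
  assumes "\<xi> \<in> space (noise T)" "\<xi> \<notin> dev a l c" "t \<le> T"
  shows "l * noise_sum \<xi> a t - l\<^sup>2 * real (npulls \<xi> a t) / 2 < c"
  using assms unfolding dev_def by (simp add: not_le) (meson not_le)

section \<open>Deterministic facts about pull counts\<close>

lemma npulls_Suc: "npulls \<xi> a (Suc t) = npulls \<xi> a t + (if pulled \<xi> (Suc t) = a then 1 else 0)"
proof -
  have "{s\<in>{1..Suc t}. pulled \<xi> s = a}
      = (if pulled \<xi> (Suc t) = a then insert (Suc t) {s\<in>{1..t}. pulled \<xi> s = a} else {s\<in>{1..t}. pulled \<xi> s = a})"
    by (auto simp: le_Suc_eq)
  then show ?thesis by (simp add: npulls_def)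
qed

lemma npulls_mono: "s \<le> t \<Longrightarrow> npulls \<xi> a s \<le> npulls \<xi> a t"
  by (rule lift_Suc_mono_le[of "npulls \<xi> a"]) (auto simp: npulls_Suc)

lemma npulls_le: "npulls \<xi> a t \<le> t"
  by (induction t) (auto simp: npulls_Suc npulls_def[of _ _ 0])

lemma npulls_K:
  assumes "a \<in> {1..K}"
  shows "npulls \<xi> a K = 1"
proof -
  have b: "bij_betw (arm \<pi> (rew \<xi>)) {1..K} {1..K}"
    using ucb1 by (simp add: is_ucb1_def)
  then obtain s where s: "s \<in> {1..K}" "pulled \<xi> s = a"
    using assms unfolding bij_betw_def pulled_def by (metis imageE)
  have "{u\<in>{1..K}. pulled \<xi> u = a} = {s}"
    using s b unfolding bij_betw_def pulled_def inj_on_def by blast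
  then show ?thesis by (simp add: npulls_def)
qed

lemma npulls_pos: "a \<in> {1..K} \<Longrightarrow> K \<le> t \<Longrightarrow> 1 \<le> npulls \<xi> a t"
  using npulls_mono[of K t \<xi> a] npulls_K[of a \<xi>] by simp

lemma sum_npulls: "t \<le> T \<Longrightarrow> (\<Sum>a\<in>{1..K}. npulls \<xi> a t) = t"
proof (induction t)
  case 0 then show ?case by (simp add: npulls_def)
next
  case (Suc t)
  have "pulled \<xi> (Suc t) \<in> {1..K}" using Suc.prems by (intro pulled_in) auto
  then show ?case using Suc by (simp add: npulls_Suc sum.distrib)
qed

lemma index_le:
  assumes "K \<le> t" "t < T" "a \<in> {1..K}"
  shows "index \<xi> a t \<le> index \<xi> (pulled \<xi> (Suc t)) t"
proof -
  have p: "pulled \<xi> (Suc t) \<in> {1..K}" using assms by (intro pulled_in) auto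
  have "Suc t \<in> {K+1..T}" using assms by auto
  then have "is_arg_max (\<lambda>a. ucb_index \<sigma> \<gamma> \<pi> (rew \<xi>) a (Suc t - 1)) (\<lambda>a. a \<in> {1..K}) (arm \<pi> (rew \<xi>) (Suc t))"
    using ucb1 unfolding is_ucb1_def by blast
  then have "ucb_index \<sigma> \<gamma> \<pi> (rew \<xi>) a t \<le> ucb_index \<sigma> \<gamma> \<pi> (rew \<xi>) (pulled \<xi> (Suc t)) t"
    using assms(3) unfolding is_arg_max_def pulled_def by (auto simp: not_less)
  then show ?thesis
    using npulls_pos[OF assms(3,1), of \<xi>] npulls_pos[OF p assms(1), of \<xi>] sigma_pos
    by (simp add: ucb_index_eq)
qed

text \<open>Each pull raises the count by one, so a given value is the count just before a pull at
  most once. The summand 1 is the initial pull.\<close>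

lemma npulls_le_card:
  assumes a: "a \<in> {1..K}"
    and Q: "\<And>t. K \<le> t \<Longrightarrow> t < T \<Longrightarrow> pulled \<xi> (Suc t) = a \<Longrightarrow> npulls \<xi> a t \<in> Q"
  shows "npulls \<xi> a T \<le> 1 + card (Q \<inter> {1..T})"
proof -
  \<comment> \<open>Only values strictly below the current count are charged, so a new pull adds
    exactly one fresh element of \<open>Q\<close>.\<close>
  have "npulls \<xi> a t \<le> 1 + card (Q \<inter> {1..<npulls \<xi> a t})" if "K \<le> t" "t \<le> T" for t
    using that
  proof (induction t rule: dec_induct)
    case base then show ?case using npulls_K[OF a] by simp
  next
    case (step t)
    show ?case
    proof (cases "pulled \<xi> (Suc t) = a")
      case True
      have "npulls \<xi> a t \<in> Q" "1 \<le> npulls \<xi> a t"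
        using step True Q[of t] npulls_pos[OF a, of t \<xi>] by auto
      moreover have "{1..<npulls \<xi> a (Suc t)} = insert (npulls \<xi> a t) {1..<npulls \<xi> a t}"
        using True \<open>1 \<le> npulls \<xi> a t\<close> by (auto simp: npulls_Suc)
      ultimately have "Q \<inter> {1..<npulls \<xi> a (Suc t)} = insert (npulls \<xi> a t) (Q \<inter> {1..<npulls \<xi> a t})"
        by simp
      then show ?thesis using step True by (simp add: npulls_Suc)
    next
      case False then show ?thesis using step by (simp add: npulls_Suc)
    qed
  qed
  from this[OF K_le_T order_refl] have "npulls \<xi> a T \<le> 1 + card (Q \<inter> {1..<npulls \<xi> a T})" .
  also have "\<dots> \<le> 1 + card (Q \<inter> {1..T})"
    using npulls_le[of \<xi> a T] by (intro add_left_mono card_mono) auto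
  finally show ?thesis .
qed

end

subsection \<open>Bounds on the expected number of pulls\<close>

text \<open>Comparison with the integral of exp (- c sqrt s) over the half-line, which equals 2 /
  c^2. The function \<open>G\<close> is the tail of this integral, and its differences
  telescope.\<close>

lemma sum_exp_neg_sqrt_le:
  fixes c :: real
  assumes "c > 0"
  shows "(\<Sum>n\<in>{1..T}. exp (- c * sqrt (real n))) \<le> 2 / c\<^sup>2"
proof -
  define G where "G s = 2 / c\<^sup>2 * ((1 + c * sqrt s) * exp (- c * sqrt s))" for s :: real
  have step: "exp (- c * sqrt (real (Suc n))) \<le> G (real n) - G (real (Suc n))" for n
  proof -
    \<comment> \<open>Differentiability is claimed only for positive \<open>s\<close> because of the
      square root; the mean value theorem needs it only inside the interval.\<close>
    have der: "(G has_real_derivative - exp (- c * sqrt s)) (at s)" if "s > 0" for s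
      unfolding G_def using that assms
      by (auto intro!: derivative_eq_intros simp: field_simps power2_eq_square)
    have cont: "continuous_on {real n..real (Suc n)} G"
      unfolding G_def by (intro continuous_intros)
    obtain z where z: "real n < z" "z < real (Suc n)"
      and eq: "G (real (Suc n)) - G (real n) = - exp (- c * sqrt z) * (real (Suc n) - real n)"
    proof (rule mvt[OF _ cont])
      show "(G has_derivative (*) (- exp (- c * sqrt s))) (at s)" if "real n < s" for s
        using der[of s] that by (simp add: has_field_derivative_def)
    qed auto
    have "exp (- c * sqrt (real (Suc n))) \<le> exp (- c * sqrt z)"
      using z assms by (simp del: of_nat_Suc)
    moreover have one: "real (Suc n) - real n = 1" by simp
    ultimately show ?thesis using eq unfolding one by linarith
  qed
  have "(\<Sum>n\<in>{1..T}. exp (- c * sqrt (real n))) \<le> G 0 - G (real T)"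
  proof (induction T)
    case (Suc T)
    then show ?case using step[of T] by simp
  qed simp
  also have "\<dots> \<le> 2 / c\<^sup>2"
    using assms by (simp add: G_def)
  finally show ?thesis .
qed

text \<open>A geometric tail starting at the ceiling of \<open>x\<close>. The last factor is 1 / (1
  - exp (- y)) \<le> 1 + 1 / y, which is equivalent to 1 + y \<le> exp y.\<close>

lemma sum_exp_neg_ge_le:
  fixes y x :: real
  assumes "y > 0" "x \<ge> 0"
  shows "(\<Sum>n\<in>{n\<in>{1..T}. real n > x}. exp (- y * real n)) \<le> exp (- y * x) * (1 + 1 / y)"
proof -
  define q where "q = exp (- y)"
  define k where "k = nat \<lceil>x\<rceil>"
  have q: "0 < q" "q < 1" using assms by (auto simp: q_def)
  have pow: "exp (- y * real n) = q ^ n" for n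
    by (simp add: q_def exp_of_nat_mult[symmetric] mult.commute)
  have k: "real k \<ge> x" and kle: "k \<le> n" if "real n > x" for n
    using that assms by (auto simp: k_def nat_le_iff ceiling_le_iff intro: less_imp_le)
  have "(\<Sum>n\<in>{n\<in>{1..T}. real n > x}. exp (- y * real n)) \<le> (\<Sum>n\<in>{k..<k + T}. q ^ n) + q ^ (k + T)"
  proof -
    have "(\<Sum>n\<in>{n\<in>{1..T}. real n > x}. exp (- y * real n)) \<le> (\<Sum>n\<in>{k..k + T}. q ^ n)"
      unfolding pow using q kle by (intro sum_mono2) auto
    then show ?thesis by (simp add: atLeastLessThanSuc_atLeastAtMost[symmetric])
  qed
  also have "\<dots> = q ^ k * (\<Sum>n<Suc T. q ^ n)"
    by (simp add: sum_distrib_left sum.shift_bounds_nat_ivl[of _ 0 k, simplified] power_add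
        lessThan_atLeast0 add.commute distrib_left)
       (simp add: mult.commute)
  also have "(\<Sum>n<Suc T. q ^ n) \<le> 1 + 1 / y"
  proof -
    have "(\<Sum>n<Suc T. q ^ n) = (1 - q ^ Suc T) / (1 - q)"
      using q by (simp add: sum_gp_strict del: sum.lessThan_Suc power_Suc)
    also have "\<dots> \<le> 1 / (1 - q)"
      using q by (intro divide_right_mono) auto
    also have "\<dots> \<le> 1 + 1 / y"
    proof -
      have "q * (1 + y) \<le> q * exp y" using q exp_ge_add_one_self[of y] by (intro mult_left_mono) auto
      also have "\<dots> = 1" by (simp add: q_def exp_add[symmetric])
      finally show ?thesis using q assms by (simp add: field_simps)
    qed
    finally show ?thesis .
  qed
  also have "q ^ k \<le> exp (- y * x)"
  proof -
    have "q ^ k = exp (- y * real k)" by (rule pow[symmetric])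
    also have "\<dots> \<le> exp (- y * x)" using assms by (simp add: k_def)
    finally show ?thesis .
  qed
  finally show ?thesis using assms q by (simp add: mult_left_mono mult_right_mono)
qed

section \<open>Upper bound on the expected pulls of a sub-optimal arm\<close>

context ucb
begin

lemma npulls_integrable: "integrable (noise T) (\<lambda>\<xi>. real (npulls \<xi> a T))"
  by (rule integrable_const_bound[where B = "real T"])
     (use npulls_le npulls_measurable in auto)

text \<open>The union bound in expectation: a sum of indicators is at least one on the union and
  enters pathwise bounds linearly.\<close>

lemma prob_dev_sum:
  assumes "finite I"
  shows "integrable (noise T) (\<lambda>\<xi>. \<Sum>i\<in>I. indicator (dev (b i) (l i) (c i)) \<xi> :: real)"
    and "expectation (\<lambda>\<xi>. \<Sum>i\<in>I. indicator (dev (b i) (l i) (c i)) \<xi>) \<le> (\<Sum>i\<in>I. exp (- c i))"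
proof -
  have i: "integrable (noise T) (indicator (dev (b i) (l i) (c i)) :: _ \<Rightarrow> real)" for i
    by (simp add: integrable_indicator_iff emeasure_eq_measure)
  then show "integrable (noise T) (\<lambda>\<xi>. \<Sum>i\<in>I. indicator (dev (b i) (l i) (c i)) \<xi> :: real)"
    by (intro Bochner_Integration.integrable_sum)
  show "expectation (\<lambda>\<xi>. \<Sum>i\<in>I. indicator (dev (b i) (l i) (c i)) \<xi>) \<le> (\<Sum>i\<in>I. exp (- c i))"
    using i by (simp add: Bochner_Integration.integral_sum) (intro sum_mono prob_dev)
qed

text \<open>The terms are the initial pull, the count beyond which the bonus of \<open>a\<close> is
  at most (1 - 2 \<theta>) d, the later counts at which the mean of \<open>a\<close> is too high by
  \<theta> d, and \<open>T\<close> times a bound on the probability that the index of the best arm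
  ever drops below - \<theta> d.\<close>

lemma expectation_npulls_le:
  assumes a: "a \<in> {1..K}" and b: "b \<in> {1..K}" "\<Delta> b = 0"
    and deq: "d = \<Delta> a / \<sigma>" and d: "d > 0" and \<theta>: "0 < \<theta>" "\<theta> < 1 / 2" and \<gamma>: "\<gamma> > 0"
  shows "expectation (\<lambda>\<xi>. real (npulls \<xi> a T)) \<le> 1 + (\<gamma> / (d * (1 - 2 * \<theta>)))\<^sup>2
    + exp (- (\<theta> * \<gamma>)\<^sup>2 / 2) * (1 + 2 / (\<theta> * d)\<^sup>2)
    + real T * (exp (- \<gamma>\<^sup>2 / 2) * (2 / (\<gamma> * \<theta> * d)\<^sup>2))"
proof -
  define n0 where "n0 = (\<gamma> / (d * (1 - 2 * \<theta>)))\<^sup>2"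
  \<comment> \<open>In both families the slope is the deviation of the mean to be detected and the
    level is half its square times \<open>n\<close>, the optimal Chernoff pairing at count
    \<open>n\<close>.\<close>
  define B where "B n = dev b (- (\<gamma> / sqrt (real n) + \<theta> * d)) ((\<gamma> + \<theta> * d * sqrt (real n))\<^sup>2 / 2)" for n
  define E where "E n = dev a (\<theta> * d) ((\<theta> * d)\<^sup>2 / 2 * real n)" for n
  define I where "I = {n\<in>{1..T}. real n > n0}"
  have "n0 \<ge> 0" by (simp add: n0_def)
  have path: "real (npulls \<xi> a T) \<le> 1 + n0 + (\<Sum>n\<in>I. indicator (E n) \<xi>)
      + real T * (\<Sum>n\<in>{1..T}. indicator (B n) \<xi>)" (is "_ \<le> ?r")
    if \<xi>: "\<xi> \<in> space (noise T)" for \<xi>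
  proof (cases "\<exists>n\<in>{1..T}. \<xi> \<in> B n")
    case True
    then obtain n where n: "n \<in> {1..T}" "\<xi> \<in> B n" by auto
    \<comment> \<open>If the best arm fails, the trivial bound \<open>T\<close> is charged to an
      indicator sum that is then at least one.\<close>
    have "(1::real) = indicator (B n) \<xi>" using n by simp
    also have "\<dots> \<le> (\<Sum>n\<in>{1..T}. indicator (B n) \<xi>)"
      by (rule member_le_sum) (use n in auto)
    finally have "real T * 1 \<le> real T * (\<Sum>n\<in>{1..T}. indicator (B n) \<xi>)"
      by (intro mult_left_mono) auto
    moreover have "(0::real) \<le> (\<Sum>n\<in>I. indicator (E n) \<xi>)" by (intro sum_nonneg) auto
    moreover have "real (npulls \<xi> a T) \<le> real T" using npulls_le[of \<xi> a T] by simp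
    ultimately show ?thesis using \<open>n0 \<ge> 0\<close> by linarith
  next
    case False
    \<comment> \<open>The counts at which \<open>a\<close> can still be chosen while the index of
      the best arm is reliable.\<close>
    define Q where "Q = {n. real n \<le> n0 \<or> \<xi> \<in> E n}"
    have floor: "real n \<le> n0 \<longleftrightarrow> n \<le> nat \<lfloor>n0\<rfloor>" for n
      using \<open>n0 \<ge> 0\<close> by (simp add: le_nat_iff le_floor_iff)
    have sub: "Q \<inter> {1..T} \<subseteq> {1..nat \<lfloor>n0\<rfloor>} \<union> {n\<in>I. \<xi> \<in> E n}"
      by (auto simp: Q_def I_def floor[symmetric])
    have "npulls \<xi> a t \<in> Q" if t: "K \<le> t" "t < T" "pulled \<xi> (Suc t) = a" for t
    proof (cases "real (npulls \<xi> a t) \<le> n0")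
      case True then show ?thesis by (simp add: Q_def)
    next
      case big: False
      define n where "n = npulls \<xi> b t"
      define l where "l = \<gamma> / sqrt (real n) + \<theta> * d"
      have n: "1 \<le> n" "n \<le> T"
        using npulls_pos[OF b(1) t(1), of \<xi>] npulls_le[of \<xi> b t] t by (auto simp: n_def)
      have l: "l > 0" unfolding l_def using n \<gamma> \<theta> d by (intro add_pos_pos divide_pos_pos mult_pos_pos) auto
      have leq: "(\<gamma> + \<theta> * d * sqrt (real n))\<^sup>2 = l\<^sup>2 * real n"
      proof -
        have "\<gamma> + \<theta> * d * sqrt (real n) = l * sqrt (real n)"
          using n by (simp add: l_def distrib_right)
        then show ?thesis by (simp add: power_mult_distrib)
      qed
      have "\<xi> \<notin> B n" using False n by auto
      then have "- l * noise_sum \<xi> b t - (- l)\<^sup>2 * real (npulls \<xi> b t) / 2 < l\<^sup>2 * real n / 2"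
        unfolding B_def l_def[symmetric] leq by (rule not_devD[OF \<xi>]) (use t in simp)
      then have "l * (- noise_sum \<xi> b t) < l * (l * real n)"
        unfolding n_def[symmetric] power2_minus unfolding power2_eq_square by argo
      then have "- noise_sum \<xi> b t < l * real n" by (simp only: mult_less_cancel_left_pos[OF l])
      then have "- l < noise_sum \<xi> b t / real n" using n by (simp add: field_simps)
      \<comment> \<open>The bonus of \<open>b\<close> cancels the \<gamma> / sqrt n part of
        \<open>l\<close>, so only \<theta> d is lost.\<close>
      then have ib: "- (\<theta> * d) < index \<xi> b t"
        using b by (simp add: index_def n_def[symmetric] l_def)
      define k where "k = npulls \<xi> a t"
      have k: "1 \<le> k" using npulls_pos[OF a t(1), of \<xi>] by (simp add: k_def)
      have "index \<xi> b t \<le> index \<xi> a t" using index_le[OF t(1,2) b(1), of \<xi>] t(3) by simp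
      with ib have ia: "d - \<theta> * d < noise_sum \<xi> a t / real k + \<gamma> / sqrt (real k)"
        by (simp add: index_def k_def[symmetric] deq[symmetric])
      \<comment> \<open>The bonus of \<open>a\<close> covers at most (1 - 2 \<theta>) d of the
        required d - \<theta> d, so the noise has to supply \<theta> d.\<close>
      have "\<gamma> / sqrt (real k) \<le> d * (1 - 2 * \<theta>)"
      proof -
        have "\<gamma> / (d * (1 - 2 * \<theta>)) = sqrt n0"
          using \<gamma> d \<theta> unfolding n0_def by simp
        also have "\<dots> \<le> sqrt (real k)" using big by (simp add: k_def)
        finally show ?thesis using k d \<theta> by (simp add: field_simps)
      qed
      then have "\<theta> * d < noise_sum \<xi> a t / real k" using ia by (simp add: algebra_simps)
      then have "\<theta> * d * real k < noise_sum \<xi> a t" using k by (simp add: field_simps)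
      then have "\<theta> * d * (\<theta> * d * real k) \<le> \<theta> * d * noise_sum \<xi> a t"
        using d \<theta> by (intro mult_left_mono) auto
      then have "(\<theta> * d)\<^sup>2 / 2 * real k \<le> \<theta> * d * noise_sum \<xi> a t - (\<theta> * d)\<^sup>2 * real (npulls \<xi> a t) / 2"
        unfolding k_def power2_eq_square by argo
      then have "\<xi> \<in> E k"
        unfolding E_def dev_def using \<xi> t(2) less_imp_le by blast
      then show ?thesis by (simp add: Q_def k_def)
    qed
    then have "npulls \<xi> a T \<le> 1 + card (Q \<inter> {1..T})"
      by (rule npulls_le_card[OF a])
    also have "1 + card (Q \<inter> {1..T}) \<le> 1 + card ({1..nat \<lfloor>n0\<rfloor>} \<union> {n\<in>I. \<xi> \<in> E n})"
      using sub by (intro add_left_mono card_mono) (auto simp: I_def)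
    also have "\<dots> \<le> 1 + (nat \<lfloor>n0\<rfloor> + card {n\<in>I. \<xi> \<in> E n})"
      using card_Un_le[of "{1..nat \<lfloor>n0\<rfloor>}" "{n\<in>I. \<xi> \<in> E n}"] by simp
    finally have "real (npulls \<xi> a T) \<le> real (1 + (nat \<lfloor>n0\<rfloor> + card {n\<in>I. \<xi> \<in> E n}))"
      by (simp only: of_nat_le_iff)
    then have "real (npulls \<xi> a T) \<le> 1 + (real (nat \<lfloor>n0\<rfloor>) + real (card {n\<in>I. \<xi> \<in> E n}))"
      by (simp only: of_nat_add of_nat_1)
    moreover have "real (nat \<lfloor>n0\<rfloor>) \<le> n0" using \<open>n0 \<ge> 0\<close> by simp
    moreover have "real (card {n\<in>I. \<xi> \<in> E n}) = (\<Sum>n\<in>I. indicator (E n) \<xi>)"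
      by (simp add: indicator_def sum.If_cases I_def Int_def)
    moreover have "0 \<le> real T * (\<Sum>n\<in>{1..T}. indicator (B n) \<xi>)"
      by (intro mult_nonneg_nonneg sum_nonneg) auto
    ultimately show ?thesis by linarith
  qed
  have fI: "finite I" by (simp add: I_def)
  note E = prob_dev_sum[OF fI, of "\<lambda>_. a" "\<lambda>_. \<theta> * d" "\<lambda>n. (\<theta> * d)\<^sup>2 / 2 * real n", folded E_def]
  note B = prob_dev_sum[of "{1..T}" "\<lambda>_. b" "\<lambda>n. - (\<gamma> / sqrt (real n) + \<theta> * d)"
      "\<lambda>n. (\<gamma> + \<theta> * d * sqrt (real n))\<^sup>2 / 2", folded B_def, OF finite_atLeastAtMost]
  have "expectation (\<lambda>\<xi>. real (npulls \<xi> a T)) \<le> expectation (\<lambda>\<xi>. 1 + n0 + (\<Sum>n\<in>I. indicator (E n) \<xi>)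
      + real T * (\<Sum>n\<in>{1..T}. indicator (B n) \<xi>))"
    by (intro integral_mono npulls_integrable Bochner_Integration.integrable_add integrable_const
        E(1) B(1) integrable_mult_right path)
  also have "\<dots> = 1 + n0 + expectation (\<lambda>\<xi>. \<Sum>n\<in>I. indicator (E n) \<xi>)
      + real T * expectation (\<lambda>\<xi>. \<Sum>n\<in>{1..T}. indicator (B n) \<xi>)"
    using E(1) B(1) by (simp add: prob_space)
  also have "\<dots> \<le> 1 + n0 + exp (- (\<theta> * \<gamma>)\<^sup>2 / 2) * (1 + 2 / (\<theta> * d)\<^sup>2)
      + real T * (exp (- \<gamma>\<^sup>2 / 2) * (2 / (\<gamma> * \<theta> * d)\<^sup>2))"
  proof -
    have "expectation (\<lambda>\<xi>. \<Sum>n\<in>I. indicator (E n) \<xi>) \<le> (\<Sum>n\<in>I. exp (- ((\<theta> * d)\<^sup>2 / 2) * real n))"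
      using E(2) by simp
    also have "\<dots> \<le> exp (- ((\<theta> * d)\<^sup>2 / 2) * n0) * (1 + 1 / ((\<theta> * d)\<^sup>2 / 2))"
      unfolding I_def using \<open>n0 \<ge> 0\<close> \<theta> d by (intro sum_exp_neg_ge_le) auto
    also have "\<dots> \<le> exp (- (\<theta> * \<gamma>)\<^sup>2 / 2) * (1 + 2 / (\<theta> * d)\<^sup>2)"
    proof -
      \<comment> \<open>Replacing \<open>n0\<close> by the smaller (\<gamma> / d)^2 cancels
        \<open>d\<close> in the exponent.\<close>
      have "\<gamma> / d \<le> \<gamma> / (d * (1 - 2 * \<theta>))"
        using \<theta> d \<gamma> by (intro divide_left_mono) (auto simp: mult_le_cancel_left1)
      then have "(\<gamma> / d)\<^sup>2 \<le> n0" unfolding n0_def using \<gamma> d by (intro power_mono) auto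
      then have "(\<theta> * d)\<^sup>2 * (\<gamma> / d)\<^sup>2 \<le> (\<theta> * d)\<^sup>2 * n0" by (intro mult_left_mono) auto
      moreover have "(\<theta> * d)\<^sup>2 * (\<gamma> / d)\<^sup>2 = (\<theta> * \<gamma>)\<^sup>2"
        using d by (simp add: power2_eq_square)
      ultimately show ?thesis by (intro mult_mono) auto
    qed
    finally have 1: "expectation (\<lambda>\<xi>. \<Sum>n\<in>I. indicator (E n) \<xi>) \<le> exp (- (\<theta> * \<gamma>)\<^sup>2 / 2) * (1 + 2 / (\<theta> * d)\<^sup>2)" .
    have "expectation (\<lambda>\<xi>. \<Sum>n\<in>{1..T}. indicator (B n) \<xi>)
        \<le> (\<Sum>n\<in>{1..T}. exp (- ((\<gamma> + \<theta> * d * sqrt (real n))\<^sup>2 / 2)))"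
      by (rule B(2))
    \<comment> \<open>After expanding the square, \<gamma>^2 / 2 and the cross term are kept; the
      cross term bounds the sum over \<open>n\<close> independently of \<open>T\<close>.\<close>
    also have "\<dots> \<le> (\<Sum>n\<in>{1..T}. exp (- \<gamma>\<^sup>2 / 2) * exp (- (\<gamma> * \<theta> * d) * sqrt (real n)))"
      by (intro sum_mono) (simp add: exp_add[symmetric] power2_sum algebra_simps)
    also have "\<dots> = exp (- \<gamma>\<^sup>2 / 2) * (\<Sum>n\<in>{1..T}. exp (- (\<gamma> * \<theta> * d) * sqrt (real n)))"
      by (simp only: sum_distrib_left)
    also have "\<dots> \<le> exp (- \<gamma>\<^sup>2 / 2) * (2 / (\<gamma> * \<theta> * d)\<^sup>2)"
      using \<gamma> \<theta> d by (intro mult_left_mono sum_exp_neg_sqrt_le) auto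
    finally have "real T * expectation (\<lambda>\<xi>. \<Sum>n\<in>{1..T}. indicator (B n) \<xi>)
       \<le> real T * (exp (- \<gamma>\<^sup>2 / 2) * (2 / (\<gamma> * \<theta> * d)\<^sup>2))"
      by (intro mult_left_mono) auto
    with 1 show ?thesis by linarith
  qed
  finally show ?thesis unfolding n0_def .
qed

section \<open>Lower bound on the expected pulls of a sub-optimal arm\<close>

lemma last_pull:
  assumes "npulls \<xi> b t = Suc n"
  shows "\<exists>s<t. pulled \<xi> (Suc s) = b \<and> npulls \<xi> b s = n"
  using assms
proof (induction t)
  case 0 then show ?case by (simp add: npulls_def)
next
  case (Suc t)
  show ?case
  proof (cases "pulled \<xi> (Suc t) = b")
    case True then show ?thesis using Suc.prems by (auto simp: npulls_Suc)
  next
    case False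
    then have "npulls \<xi> b t = Suc n" using Suc.prems by (simp add: npulls_Suc)
    then show ?thesis using Suc.IH less_Suc_eq by blast
  qed
qed

lemma frequent_arm:
  assumes "1 \<le> K" "real K * x \<le> real T"
  shows "\<exists>b\<in>{1..K}. x \<le> real (npulls \<xi> b T)"
proof (rule ccontr)
  assume "\<not> ?thesis"
  then have *: "real (npulls \<xi> b T) < x" if "b \<in> {1..K}" for b using that by (meson not_le)
  have "real T = (\<Sum>b\<in>{1..K}. real (npulls \<xi> b T))"
    using sum_npulls[of T \<xi>] by (metis of_nat_sum order_refl)
  also have "\<dots> < (\<Sum>b\<in>{1..K}. x)" using assms * by (intro sum_strict_mono) auto
  finally show False using assms by simp
qed

text \<open>Some arm has N + 1 pulls, and just before the last of them its index is below x +
  \<gamma> / sqrt N on the good event. It beats \<open>a\<close>, so mean noise plus bonus of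
  \<open>a\<close> is below \<open>D\<close>. With fewer than \<open>n1\<close> pulls the bonus
  alone exceeds D / (1 - \<kappa>), which forces a low mean.\<close>

lemma expectation_npulls_ge:
  fixes x N D d \<kappa> :: real and J :: nat
  assumes a: "a \<in> {1..K}" and nonneg: "\<And>b. b \<in> {1..K} \<Longrightarrow> \<Delta> b \<ge> 0"
    and deq: "d = \<Delta> a / \<sigma>" and d: "d > 0" and \<kappa>: "0 < \<kappa>" "\<kappa> < 1" and \<gamma>: "\<gamma> > 0" and x: "x > 0"
    and N: "1 \<le> N" "real K * (N + 1) \<le> real T"
    and D: "D = d + x + \<gamma> / sqrt N" and J: "T < 2 ^ Suc J"
  shows "((1 - \<kappa>) * \<gamma> / D)\<^sup>2 * (1 - (real K * exp (- x\<^sup>2 * N / 2) + exp (- (\<kappa> * \<gamma>)\<^sup>2 / 8)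
    + (real J + 1) * exp (- \<gamma>\<^sup>2 / 16))) \<le> expectation (\<lambda>\<xi>. real (npulls \<xi> a T))"
proof -
  define n1 where "n1 = ((1 - \<kappa>) * \<gamma> / D)\<^sup>2"
  \<comment> \<open>One slope serves all counts n \<ge> N: a noise sum of at least x n makes the
    exponent at least x^2 n / 2. All arms are included because the frequent arm is random.\<close>
  define U where "U b = dev b x (x\<^sup>2 * N / 2)" for b
  \<comment> \<open>The slope is chosen so that on the block next to \<open>n1\<close> the linear
    gain exceeds (\<kappa> \<gamma>)^2 / 4 while the quadratic cost is at most (\<kappa> \<gamma>)^2
    / 8.\<close>
  define V where "V = dev a (- (\<kappa> * D / 2)) ((\<kappa> * \<gamma>)\<^sup>2 / 8)"
  \<comment> \<open>The slope is adapted to counts between 2^k and 2^(k+1): uniformly there, the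
    gain is at least \<gamma>^2 / 8 and the cost at most \<gamma>^2 / 16.\<close>
  define W where "W k = dev a (- (\<gamma> / (4 * sqrt (2 ^ k)))) (\<gamma>\<^sup>2 / 16)" for k :: nat
  define X where "X \<xi> = (\<Sum>b\<in>{1..K}. indicator (U b) \<xi>) + (\<Sum>k\<in>{0::nat}. indicator V \<xi>)
    + (\<Sum>k\<in>{..J}. indicator (W k) \<xi> :: real)" for \<xi>
  have Dpos: "D > 0" unfolding D using d x \<gamma> N by (intro add_pos_pos divide_pos_pos) auto
  have n1: "0 \<le> n1" by (simp add: n1_def)
  have K1: "1 \<le> K" using a by auto
  have good: "n1 \<le> real (npulls \<xi> a T)" if \<xi>: "\<xi> \<in> space (noise T)"
    and nU: "\<And>b. b \<in> {1..K} \<Longrightarrow> \<xi> \<notin> U b" and nV: "\<xi> \<notin> V" and nW: "\<And>k. k \<le> J \<Longrightarrow> \<xi> \<notin> W k" for \<xi>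
  proof (rule ccontr)
    assume few: "\<not> n1 \<le> real (npulls \<xi> a T)"
    obtain b where b: "b \<in> {1..K}" "N + 1 \<le> real (npulls \<xi> b T)"
      using frequent_arm[OF K1 N(2)] by blast
    then obtain n' where "npulls \<xi> b T = Suc n'" using N(1) by (cases "npulls \<xi> b T") auto
    from last_pull[OF this] b obtain t where t: "t < T" "pulled \<xi> (Suc t) = b" "npulls \<xi> b T = Suc (npulls \<xi> b t)"
      using \<open>npulls \<xi> b T = Suc n'\<close> by auto
    define n where "n = npulls \<xi> b t"
    have n: "N \<le> real n" using b t by (simp add: n_def)
    \<comment> \<open>During initialisation this pull of \<open>b\<close> would be its first, giving
      n = 0 against n \<ge> N \<ge> 1. Hence the maximality rule applies at this round.\<close>
    have "K \<le> t"
    proof (rule ccontr)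
      assume "\<not> K \<le> t"
      then have "npulls \<xi> b (Suc t) \<le> npulls \<xi> b K" by (intro npulls_mono) auto
      also have "\<dots> = 1" by (rule npulls_K[OF b(1)])
      finally have "n = 0" using t(2) by (simp add: npulls_Suc n_def)
      then show False using n N by simp
    qed
    define s where "s = noise_sum \<xi> b t"
    have "x * s - x\<^sup>2 * real n / 2 < x\<^sup>2 * N / 2"
      unfolding s_def n_def by (rule not_devD[OF \<xi>]) (use nU[OF b(1)] t in \<open>auto simp: U_def\<close>)
    also have "\<dots> \<le> x\<^sup>2 * real n / 2" using n by (intro divide_right_mono mult_left_mono) auto
    finally have "x * s < x * (x * real n)" unfolding power2_eq_square by argo
    then have "s < x * real n" by (simp only: mult_less_cancel_left_pos[OF x])
    then have "s / real n < x" using n N by (simp add: field_simps)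
    moreover have "\<gamma> / sqrt (real n) \<le> \<gamma> / sqrt N"
      using n N \<gamma> by (intro divide_left_mono) auto
    \<comment> \<open>Whichever arm is frequent, its own gap only lowers its index.\<close>
    moreover have "0 \<le> \<Delta> b / \<sigma>" using nonneg[OF b(1)] sigma_pos by simp
    moreover have "index \<xi> b t = s / real n + \<gamma> / sqrt (real n) - \<Delta> b / \<sigma>"
      by (simp add: index_def s_def n_def)
    moreover have "index \<xi> a t \<le> index \<xi> b t"
      using index_le[OF \<open>K \<le> t\<close> t(1) a, of \<xi>] t(2) by simp
    moreover define k where "k = npulls \<xi> a t"
    moreover define r where "r = noise_sum \<xi> a t"
    moreover have "index \<xi> a t = r / real k + \<gamma> / sqrt (real k) - d"
      by (simp add: index_def r_def k_def deq)
    ultimately have idx: "r / real k + \<gamma> / sqrt (real k) < D" unfolding D by linarith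
    have k1: "1 \<le> k" using npulls_pos[OF a \<open>K \<le> t\<close>, of \<xi>] by (simp add: k_def)
    define q where "q = sqrt (real k)"
    have q: "q > 0" "q * q = real k" using k1 by (auto simp: q_def)
    have r: "r < D * (q * q) - \<gamma> * q"
    proof -
      have "r / (q * q) + \<gamma> / q < D" using idx unfolding q_def[symmetric] unfolding q(2)[symmetric] .
      then have "(r / (q * q) + \<gamma> / q) * (q * q) < D * (q * q)" using q(1) by (intro mult_strict_right_mono) auto
      moreover have "(r / (q * q) + \<gamma> / q) * (q * q) = r + \<gamma> * q" using q(1) by (simp add: field_simps)
      ultimately show ?thesis by simp
    qed
    have "k \<le> npulls \<xi> a T" unfolding k_def using t by (intro npulls_mono) auto
    then have "real k < n1" using few by linarith
    then have "q < sqrt n1" unfolding q_def by simp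
    also have "sqrt n1 = (1 - \<kappa>) * \<gamma> / D"
      unfolding n1_def using \<kappa> \<gamma> Dpos by (subst real_sqrt_abs) auto
    finally have Dq: "D * q < (1 - \<kappa>) * \<gamma>" using Dpos by (simp add: field_simps)
    show False
    \<comment> \<open>Counts of the order of \<open>n1\<close> form one block; smaller counts are peeled dyadically.\<close>
    proof (cases "\<gamma> / 2 < D * q")
      case True
      have "\<kappa> * \<gamma> * (D * q) \<le> D * ((\<gamma> - D * q) * q)"
      proof -
        have "\<kappa> * \<gamma> * (D * q) \<le> (\<gamma> - D * q) * (D * q)"
          using Dq Dpos q by (intro mult_right_mono) (auto simp: algebra_simps)
        then show ?thesis by (simp add: ac_simps)
      qed
      moreover have "\<kappa> * \<gamma> * (\<gamma> / 2) < \<kappa> * \<gamma> * (D * q)"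
        using True \<kappa> \<gamma> by (intro mult_strict_left_mono) auto
      moreover have "D * ((\<gamma> - D * q) * q) \<le> D * (- r)"
        using r Dpos by (intro mult_left_mono) (auto simp: algebra_simps)
      ultimately have "\<kappa> * \<gamma> * (\<gamma> / 2) < D * (- r)" by linarith
      then have "\<kappa> / 2 * (\<kappa> * \<gamma> * (\<gamma> / 2)) < \<kappa> / 2 * (D * (- r))"
        using \<kappa> by (intro mult_strict_left_mono) auto
      moreover have "(\<kappa> * (D * q)) * (\<kappa> * (D * q)) \<le> (\<kappa> * \<gamma>) * (\<kappa> * \<gamma>)"
      proof -
        have "(1 - \<kappa>) * \<gamma> \<le> 1 * \<gamma>" using \<kappa> \<gamma> by (intro mult_right_mono) auto
        then have "D * q \<le> \<gamma>" using Dq by simp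
        then have "\<kappa> * (D * q) \<le> \<kappa> * \<gamma>" using \<kappa> by (intro mult_left_mono) auto
        then show ?thesis using \<kappa> \<gamma> Dpos q by (intro mult_mono) auto
      qed
      moreover have "- (\<kappa> * D / 2) * r - (- (\<kappa> * D / 2))\<^sup>2 * real k / 2 < (\<kappa> * \<gamma>)\<^sup>2 / 8"
        unfolding r_def k_def by (rule not_devD[OF \<xi>]) (use nV t in \<open>auto simp: V_def\<close>)
      ultimately show False
        unfolding q(2)[symmetric] power2_eq_square by argo
    next
      case False
      obtain j where j: "2 ^ j \<le> k" "k < 2 ^ (j + 1)"
        using ex_power_ivl1[of 2 k] k1 by auto
      have "k \<le> T" using npulls_le[of \<xi> a t] t by (simp add: k_def)
      then have "(2::nat) ^ j < 2 ^ Suc J" using j J by linarith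
      then have "j \<le> J" by (metis less_Suc_eq_le one_less_numeral_iff power_less_imp_less_exp semiring_norm(76))
      define p where "p = sqrt (2 ^ j :: real)"
      have p: "p > 0" "p * p = 2 ^ j" by (auto simp: p_def)
      have k2: "(2::real) ^ j \<le> real k" "real k < 2 * 2 ^ j"
      proof -
        have "real (2 ^ j) \<le> real k" "real k < real (2 ^ (j + 1))"
          using j by (simp_all only: of_nat_le_iff of_nat_less_iff)
        then show "(2::real) ^ j \<le> real k" "real k < 2 * 2 ^ j" by simp_all
      qed
      have pq: "p \<le> q" unfolding p_def q_def using k2 by simp
      define u where "u = q / p"
      have u1: "1 \<le> u" using pq p by (simp add: u_def)
      have uu: "u * u \<le> 2" using k2 p q unfolding u_def by (simp add: field_simps)
      \<comment> \<open>For small counts the bonus is at least 2 D, so the noise sum falls below -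
        \<gamma> q / 2 whatever the value of \<open>D\<close>.\<close>
      have rr: "\<gamma> / 2 * q \<le> - r"
      proof -
        have "\<gamma> / 2 * q \<le> (\<gamma> - D * q) * q" using False q by (intro mult_right_mono) auto
        then show ?thesis using r by (simp add: algebra_simps)
      qed
      have "- (\<gamma> / (4 * p)) * r - (- (\<gamma> / (4 * p)))\<^sup>2 * real k / 2 < \<gamma>\<^sup>2 / 16"
        unfolding r_def k_def p_def by (rule not_devD[OF \<xi>]) (use nW[OF \<open>j \<le> J\<close>] t in \<open>auto simp: W_def\<close>)
      moreover have "(- (\<gamma> / (4 * p)))\<^sup>2 * real k / 2 = \<gamma>\<^sup>2 * (u * u) / 32"
        unfolding q(2)[symmetric] u_def using p by (simp add: field_simps power2_eq_square)
      moreover have "\<gamma>\<^sup>2 * u / 8 \<le> - (\<gamma> / (4 * p)) * r"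
      proof -
        have "\<gamma> / (4 * p) * (\<gamma> / 2 * q) \<le> \<gamma> / (4 * p) * (- r)"
          using rr \<gamma> p by (intro mult_left_mono) auto
        moreover have "\<gamma> / (4 * p) * (\<gamma> / 2 * q) = \<gamma>\<^sup>2 * u / 8"
          unfolding u_def by (simp add: field_simps power2_eq_square)
        ultimately show ?thesis by simp
      qed
      moreover have "\<gamma>\<^sup>2 * (u * u) \<le> \<gamma>\<^sup>2 * 2" using uu by (intro mult_left_mono) auto
      moreover have "\<gamma>\<^sup>2 * 1 \<le> \<gamma>\<^sup>2 * u" using u1 by (intro mult_left_mono) auto
      ultimately show False by linarith
    qed
  qed
  \<comment> \<open>If \<open>X\<close> is at least 1 the left side is nonpositive; otherwise no bad
    event occurs and \<open>good\<close> applies.\<close>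
  have path: "n1 * (1 - X \<xi>) \<le> real (npulls \<xi> a T)" if \<xi>: "\<xi> \<in> space (noise T)" for \<xi>
  proof (cases "X \<xi> \<ge> 1")
    case True
    then have "n1 * (1 - X \<xi>) \<le> 0" using n1 by (simp add: mult_nonneg_nonpos)
    then show ?thesis by (rule order_trans) simp
  next
    case False
    have nn: "0 \<le> (\<Sum>b\<in>{1..K}. indicator (U b) \<xi> :: real)" "0 \<le> (\<Sum>k\<in>{..J}. indicator (W k) \<xi> :: real)"
      "0 \<le> (indicator V \<xi> :: real)" by (auto intro!: sum_nonneg)
    have "\<xi> \<notin> U b" if "b \<in> {1..K}" for b
    proof
      assume "\<xi> \<in> U b"
      then have "1 \<le> (\<Sum>b\<in>{1..K}. indicator (U b) \<xi> :: real)"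
        using member_le_sum[of b "{1..K}" "\<lambda>b. indicator (U b) \<xi> :: real"] that by simp
      then show False using False nn by (simp add: X_def del: sum_indicator_eq_card)
    qed
    moreover have "\<xi> \<notin> V" using False nn by (auto simp: X_def)
    moreover have "\<xi> \<notin> W k" if "k \<le> J" for k
    proof
      assume "\<xi> \<in> W k"
      then have "1 \<le> (\<Sum>k\<in>{..J}. indicator (W k) \<xi> :: real)"
        using member_le_sum[of k "{..J}" "\<lambda>k. indicator (W k) \<xi> :: real"] that by simp
      then show False using False nn by (simp add: X_def del: sum_indicator_eq_card)
    qed
    ultimately have "n1 \<le> real (npulls \<xi> a T)" by (rule good[OF \<xi>])
    moreover have "0 \<le> X \<xi>" unfolding X_def by (intro add_nonneg_nonneg sum_nonneg) auto
    then have "n1 * (1 - X \<xi>) \<le> n1 * 1" using n1 by (intro mult_left_mono) auto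
    ultimately show ?thesis by linarith
  qed
  note U = prob_dev_sum[of "{1..K}" "\<lambda>b. b" "\<lambda>_. x" "\<lambda>_. x\<^sup>2 * N / 2", folded U_def, OF finite_atLeastAtMost]
  note V = prob_dev_sum[of "{0::nat}" "\<lambda>_. a" "\<lambda>_. - (\<kappa> * D / 2)" "\<lambda>_. (\<kappa> * \<gamma>)\<^sup>2 / 8", folded V_def, OF finite.insertI[OF finite.emptyI]]
  note W = prob_dev_sum[of "{..J}" "\<lambda>_. a" "\<lambda>k. - (\<gamma> / (4 * sqrt (2 ^ k)))" "\<lambda>_. \<gamma>\<^sup>2 / 16", folded W_def, OF finite_atMost]
  have XI: "integrable (noise T) X" unfolding X_def
    by (intro Bochner_Integration.integrable_add U(1) V(1) W(1))
  have "expectation X \<le> real K * exp (- x\<^sup>2 * N / 2) + exp (- (\<kappa> * \<gamma>)\<^sup>2 / 8) + (real J + 1) * exp (- \<gamma>\<^sup>2 / 16)"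
  proof -
    have "expectation X = expectation (\<lambda>\<xi>. \<Sum>b\<in>{1..K}. indicator (U b) \<xi>)
        + expectation (\<lambda>\<xi>. \<Sum>k\<in>{0::nat}. indicator V \<xi>) + expectation (\<lambda>\<xi>. \<Sum>k\<in>{..J}. indicator (W k) \<xi>)"
      unfolding X_def using U(1) V(1) W(1) by (subst Bochner_Integration.integral_add Bochner_Integration.integrable_add; simp)+
    also have "\<dots> \<le> (\<Sum>b\<in>{1..K}. exp (- (x\<^sup>2 * N / 2))) + (\<Sum>k\<in>{0::nat}. exp (- ((\<kappa> * \<gamma>)\<^sup>2 / 8)))
        + (\<Sum>k\<in>{..J}. exp (- (\<gamma>\<^sup>2 / 16)))"
      by (intro add_mono U(2) V(2) W(2))
    finally show ?thesis by (simp add: add.commute)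
  qed
  then have "n1 * (1 - (real K * exp (- x\<^sup>2 * N / 2) + exp (- (\<kappa> * \<gamma>)\<^sup>2 / 8) + (real J + 1) * exp (- \<gamma>\<^sup>2 / 16)))
      \<le> n1 * (1 - expectation X)"
    using n1 by (intro mult_left_mono) auto
  also have "\<dots> = expectation (\<lambda>\<xi>. n1 * (1 - X \<xi>))" using XI by (simp add: prob_space)
  also have "\<dots> \<le> expectation (\<lambda>\<xi>. real (npulls \<xi> a T))"
    using XI by (intro integral_mono npulls_integrable path integrable_mult_right Bochner_Integration.integrable_diff integrable_const)
  finally show ?thesis unfolding n1_def .
qed

end

subsection \<open>Comparison with the Lai-Robbins regret\<close>

text \<open>The threshold 1024 gives sqrt l \<ge> 32, hence ln l \<le> 2 sqrt l \<le> l / 16 and e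
  \<le> 1 / 4. The choice of \<open>e\<close> makes exp (- e^2 l) equal to 1 / l.\<close>

lemma ln_ratio_bounds:
  fixes l :: real
  defines "e \<equiv> sqrt (ln l / l)"
  assumes l: "l \<ge> 1024"
  shows "1 \<le> ln l" "0 < e" "e \<le> 1 / 4" "e\<^sup>2 * l = ln l" "1 / l \<le> e"
proof -
  show ln1: "1 \<le> ln l" using l exp_le by (subst ln_ge_iff) auto
  show "0 < e" using ln1 l by (simp add: e_def)
  show sq: "e\<^sup>2 * l = ln l" using ln1 l by (simp add: e_def)
  have "ln l = 2 * ln (sqrt l)" using l by (simp add: ln_sqrt)
  also have "\<dots> \<le> 2 * sqrt l" using ln_le_minus_one[of "sqrt l"] l by simp
  also have "\<dots> \<le> l / 16"
  proof -
    have "32 * sqrt l \<le> sqrt l * sqrt l"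
      using l real_le_rsqrt[of 32 l] by (intro mult_right_mono) auto
    then show ?thesis using l by simp
  qed
  finally have "ln l / l \<le> (1 / 4)\<^sup>2" using l by (simp add: field_simps power2_eq_square)
  then show "e \<le> 1 / 4" unfolding e_def by (intro real_le_lsqrt) auto
  have "(1 / l)\<^sup>2 \<le> ln l / l"
  proof -
    have "1 / l \<le> 1" using l by simp
    then have "1 / l \<le> ln l" using ln1 by linarith
    then have "1 / l * (1 / l) \<le> 1 / l * ln l" using l by (intro mult_left_mono) auto
    then show ?thesis by (simp add: power2_eq_square)
  qed
  then show "1 / l \<le> e" unfolding e_def by (rule real_le_rsqrt)
qed

section \<open>Expected counts compared with the Lai-Robbins count\<close>

context ucb
begin

text \<open>The instance \<theta> = e of \<open>expectation_npulls_le\<close>. Every term is charged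
  to (\<gamma> / d)^2, and 1 / l \<le> e makes the deviation terms of relative order
  \<open>e\<close>.\<close>

lemma expectation_npulls_upper:
  fixes l e \<eta> d :: real
  defines "l \<equiv> ln (real T)" and "e \<equiv> sqrt (ln (ln (real T)) / ln (real T))"
  assumes l: "1024 \<le> l" and T: "T > 0" and \<gamma>: "\<gamma> = sqrt (2 * l)"
    and a: "a \<in> {1..K}" and b: "b \<in> {1..K}" "\<Delta> b = 0"
    and deq: "d = \<Delta> a / \<sigma>" and d: "d > 0" "d \<le> \<eta> * sqrt l"
  shows "expectation (\<lambda>\<xi>. real (npulls \<xi> a T)) \<le> (\<gamma> / d)\<^sup>2 * (1 + 14 * e + \<eta>\<^sup>2)"
proof -
  have e_def': "e = sqrt (ln l / l)" by (simp add: e_def l_def)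
  note e = ln_ratio_bounds[OF l, folded e_def']
  have l0: "l > 0" using l by simp
  have g2: "\<gamma>\<^sup>2 = 2 * l" "\<gamma> > 0" using l by (auto simp: \<gamma>)
  have bound: "expectation (\<lambda>\<xi>. real (npulls \<xi> a T)) \<le> 1 + (\<gamma> / (d * (1 - 2 * e)))\<^sup>2
    + exp (- (e * \<gamma>)\<^sup>2 / 2) * (1 + 2 / (e * d)\<^sup>2) + real T * (exp (- \<gamma>\<^sup>2 / 2) * (2 / (\<gamma> * e * d)\<^sup>2))"
    using e g2 d by (intro expectation_npulls_le[OF a b deq]) auto
  have n: "(\<gamma> / d)\<^sup>2 = 2 * l / d\<^sup>2" by (simp add: power_divide g2)
  \<comment> \<open>Gaps of at most \<eta> sqrt l make the Lai-Robbins count at least 2 / \<eta>^2,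
    so an additive 1 has relative cost \<eta>^2 / 2.\<close>
  have one: "1 \<le> (\<gamma> / d)\<^sup>2 * (\<eta>\<^sup>2 / 2)"
  proof -
    have "d\<^sup>2 \<le> (\<eta> * sqrt l)\<^sup>2" using d by (intro power_mono) auto
    also have "\<dots> = \<eta>\<^sup>2 * l" using l0 by (simp add: power_mult_distrib)
    finally show ?thesis unfolding n using d by (simp add: field_simps)
  qed
  have t1: "(\<gamma> / (d * (1 - 2 * e)))\<^sup>2 \<le> (\<gamma> / d)\<^sup>2 * (1 + 12 * e)"
  proof -
    have "1 \<le> (1 + 12 * e) * (1 - 2 * e)\<^sup>2"
    proof -
      have "(1 + 12 * e) * (1 - 2 * e)\<^sup>2 - 1 = 4 * e * (1 - 4 * e) * (2 - 3 * e)"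
        by (simp add: power2_eq_square algebra_simps)
      moreover have "0 \<le> 4 * e * (1 - 4 * e) * (2 - 3 * e)"
        using e by (intro mult_nonneg_nonneg) auto
      ultimately show ?thesis by linarith
    qed
    then have "1 / (1 - 2 * e)\<^sup>2 \<le> 1 + 12 * e" using e by (simp add: field_simps)
    then have "(\<gamma> / d)\<^sup>2 * (1 / (1 - 2 * e)\<^sup>2) \<le> (\<gamma> / d)\<^sup>2 * (1 + 12 * e)"
      by (intro mult_left_mono) auto
    then show ?thesis by (simp add: power_divide power_mult_distrib)
  qed
  have ed: "(e * d)\<^sup>2 = ln l * d\<^sup>2 / l" using e(4) l0 by (simp add: power_mult_distrib field_simps)
  have inv: "2 / (e * d)\<^sup>2 \<le> (\<gamma> / d)\<^sup>2"
  proof -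
    have ln0: "ln l > 0" using e(1) by linarith
    have "d\<^sup>2 \<le> ln l * d\<^sup>2" using e(1) mult_right_mono[of 1 "ln l" "d\<^sup>2"] by simp
    then have "2 * l / (ln l * d\<^sup>2) \<le> 2 * l / d\<^sup>2"
      using l0 d(1) ln0 by (intro divide_left_mono mult_pos_pos) auto
    then show ?thesis unfolding ed n by simp
  qed
  have exp1: "exp (- (e * \<gamma>)\<^sup>2 / 2) = 1 / l"
  proof -
    have "(e * \<gamma>)\<^sup>2 / 2 = ln l" using e(4) g2 by (simp add: power_mult_distrib)
    then have "- (e * \<gamma>)\<^sup>2 / 2 = - ln l" by simp
    then show ?thesis using l0 by (simp add: exp_minus inverse_eq_divide)
  qed
  have t2: "exp (- (e * \<gamma>)\<^sup>2 / 2) * (1 + 2 / (e * d)\<^sup>2) \<le> (\<gamma> / d)\<^sup>2 * (\<eta>\<^sup>2 / 2) + (\<gamma> / d)\<^sup>2 * e"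
  proof -
    have "1 / l * (1 + 2 / (e * d)\<^sup>2) \<le> 1 / l * (1 + (\<gamma> / d)\<^sup>2)"
      using inv l0 by (intro mult_left_mono) auto
    also have "\<dots> = 1 / l + (\<gamma> / d)\<^sup>2 * (1 / l)" unfolding distrib_left by simp
    also have "\<dots> \<le> 1 + (\<gamma> / d)\<^sup>2 * e" using l e(5) by (intro add_mono mult_left_mono) auto
    finally show ?thesis unfolding exp1 using one by linarith
  qed
  have t3: "real T * (exp (- \<gamma>\<^sup>2 / 2) * (2 / (\<gamma> * e * d)\<^sup>2)) \<le> (\<gamma> / d)\<^sup>2 * e"
  proof -
    \<comment> \<open>With \<gamma>^2 = 2 ln T this factor cancels the trivial bound
      \<open>T\<close> exactly.\<close>
    have "exp (- \<gamma>\<^sup>2 / 2) = 1 / real T"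
      using T by (simp add: g2 l_def exp_minus inverse_eq_divide)
    then have "real T * (exp (- \<gamma>\<^sup>2 / 2) * (2 / (\<gamma> * e * d)\<^sup>2)) = 2 / (\<gamma> * e * d)\<^sup>2"
      using T by simp
    also have "\<dots> = 2 / (e * d)\<^sup>2 * (1 / (2 * l))"
      by (simp add: power_mult_distrib g2)
    also have "\<dots> \<le> (\<gamma> / d)\<^sup>2 * (1 / l)"
      using inv l0 by (intro mult_mono) (auto simp: field_simps)
    also have "\<dots> \<le> (\<gamma> / d)\<^sup>2 * e" using e(5) by (intro mult_left_mono) auto
    finally show ?thesis .
  qed
  \<comment> \<open>The error budget: 14 e splits into 12 e + e + e, and \<eta>^2 into two
    halves.\<close>
  have "M * (1 + 14 * e + h) = M * (h / 2) + M * (1 + 12 * e) + (M * (h / 2) + M * e) + M * e" for M h :: real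
    by (simp add: algebra_simps)
  note this[of "(\<gamma> / d)\<^sup>2" "\<eta>\<^sup>2"]
  with bound one t1 t2 t3 show ?thesis by linarith
qed

text \<open>The instance x = 4 h, N = T / (2 K), \<kappa> = 2 e of
  \<open>expectation_npulls_ge\<close>. The bonus at count \<open>N\<close> is 2 h, so D = d + 6 h,
  which is at most d (1 + 6 / L) by the lower bound on the gap.\<close>

lemma expectation_npulls_lower:
  fixes l e d L :: real
  defines "l \<equiv> ln (real T)" and "e \<equiv> sqrt (ln (ln (real T)) / ln (real T))"
  assumes l: "1024 \<le> l" and T: "2 * K \<le> T" and \<gamma>: "\<gamma> = sqrt (2 * l)"
    and a: "a \<in> {1..K}" and nonneg: "\<And>b. b \<in> {1..K} \<Longrightarrow> \<Delta> b \<ge> 0"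
    and deq: "d = \<Delta> a / \<sigma>" and d: "L * sqrt (real K * l / real T) \<le> d" and L: "12 \<le> L"
  shows "(\<gamma> / d)\<^sup>2 * (1 - (774 * e + 12 / L)) \<le> expectation (\<lambda>\<xi>. real (npulls \<xi> a T))"
proof -
  have e_def': "e = sqrt (ln l / l)" by (simp add: e_def l_def)
  note e = ln_ratio_bounds[OF l, folded e_def']
  have l0: "l > 0" using l by simp
  have g2: "\<gamma>\<^sup>2 = 2 * l" "\<gamma> > 0" using l by (auto simp: \<gamma>)
  have K: "0 < real K" and TK: "2 * real K \<le> real T" using a T by auto
  then have T0: "0 < real T" by linarith
  define h where "h = sqrt (real K * l / real T)"
  \<comment> \<open>Half of the average count, so that K (N + 1) = T / 2 + K \<le> T.\<close>
  define N where "N = real T / (2 * real K)"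
  have h: "h > 0" "h\<^sup>2 = real K * l / real T" using K l0 T0 by (auto simp: h_def)
  have d0: "d > 0" using d L h unfolding h_def[symmetric] by (meson less_le_trans mult_pos_pos zero_less_numeral)
  obtain J where J: "2 ^ J \<le> T" "T < 2 ^ Suc J" using ex_power_ivl1[of 2 T] T0 by auto
  have hN: "\<gamma> / sqrt N = 2 * h"
  proof -
    have "\<gamma> / sqrt N = sqrt (2 * l / N)" by (simp add: \<gamma> real_sqrt_divide)
    also have "2 * l / N = 2\<^sup>2 * (real K * l / real T)" using K by (simp add: N_def field_simps)
    also have "sqrt \<dots> = 2 * h" unfolding h_def real_sqrt_mult by simp
    finally show ?thesis .
  qed
  define D where "D = d + 6 * h"
  define P where "P = real K * exp (- (4 * h)\<^sup>2 * N / 2) + exp (- (2 * e * \<gamma>)\<^sup>2 / 8)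
    + (real J + 1) * exp (- \<gamma>\<^sup>2 / 16)"
  have bound: "((1 - 2 * e) * \<gamma> / D)\<^sup>2 * (1 - P) \<le> expectation (\<lambda>\<xi>. real (npulls \<xi> a T))"
    unfolding P_def
  proof (rule expectation_npulls_ge[OF a nonneg deq d0 _ _ g2(2) _ _ _ _ J(2)])
    show "D = d + 4 * h + \<gamma> / sqrt N" by (simp add: D_def hN)
    show "1 \<le> N" using K TK by (simp add: N_def)
    show "real K * (N + 1) \<le> real T" using K TK by (simp add: N_def field_simps)
  qed (use e h in auto)
  \<comment> \<open>The three summands of \<open>P\<close> contribute 1, 1 and 768 in units of 1 /
    l.\<close>
  have "P \<le> 770 / l"
  proof -
    have "(4 * h)\<^sup>2 * N / 2 = 4 * l"
      unfolding power_mult_distrib h N_def using K T0 by (simp add: field_simps)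
    then have "real K * exp (- (4 * h)\<^sup>2 * N / 2) = real K * exp (- (4 * l))" by simp
    \<comment> \<open>The union over arms costs a factor K \<le> T = exp l, which the exponent 4 l
      absorbs.\<close>
    also have "\<dots> \<le> exp l * exp (- (4 * l))"
      using TK T0 K by (intro mult_right_mono) (auto simp: l_def)
    also have "\<dots> \<le> exp (- l)" using l0 by (simp add: exp_add[symmetric])
    also have "\<dots> \<le> 1 / l"
    proof -
      have "l \<le> exp l" using exp_ge_add_one_self[of l] by linarith
      then show ?thesis using l0 by (simp add: exp_minus field_simps)
    qed
    finally have p1: "real K * exp (- (4 * h)\<^sup>2 * N / 2) \<le> 1 / l" .
    have "(2 * e * \<gamma>)\<^sup>2 / 8 = ln l" using e(4) by (simp add: power_mult_distrib g2)
    then have "- (2 * e * \<gamma>)\<^sup>2 / 8 = - ln l" by simp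
    then have p2: "exp (- (2 * e * \<gamma>)\<^sup>2 / 8) = 1 / l" using l0 by (simp add: exp_minus inverse_eq_divide)
    \<comment> \<open>There are at most 3 l dyadic blocks, each of probability at most exp (- l / 8)
      \<le> 256 / l^2.\<close>
    have "(real J + 1) * exp (- \<gamma>\<^sup>2 / 16) \<le> (3 * l) * (256 / l\<^sup>2)"
    proof (intro mult_mono)
      have "1 / 2 \<le> ln (2::real)" using ln_le_minus_one[of "1 / 2"] by (simp add: ln_div)
      then have "real J * (1 / 2) \<le> real J * ln 2" by (intro mult_left_mono) auto
      also have "\<dots> = ln (2 ^ J)" by (simp add: ln_realpow)
      also have "\<dots> \<le> l"
      proof -
        have "real (2 ^ J) \<le> real T" using J(1) by (simp only: of_nat_le_iff)
        then show ?thesis using T0 unfolding l_def by (subst ln_le_cancel_iff) auto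
      qed
      finally show "real J + 1 \<le> 3 * l" using l by simp
      have "l / 16 \<le> exp (l / 16)" using exp_ge_add_one_self[of "l / 16"] by linarith
      then have "(l / 16)\<^sup>2 \<le> (exp (l / 16))\<^sup>2" using l0 by (intro power_mono) auto
      also have "\<dots> = exp (l / 8)" by (simp add: power2_eq_square exp_add[symmetric])
      finally have "exp (- (l / 8)) \<le> 256 / l\<^sup>2"
        using l0 by (simp add: exp_minus field_simps power2_eq_square)
      then show "exp (- \<gamma>\<^sup>2 / 16) \<le> 256 / l\<^sup>2" by (simp add: g2)
    qed (use l0 in auto)
    also have "\<dots> = 768 / l" using l0 by (simp add: field_simps power2_eq_square)
    finally show ?thesis unfolding P_def using p1 p2 by simp
  qed
  moreover have "770 / l \<le> 770 * e" using e(5) by simp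
  moreover have "770 / l \<le> 1" using l by simp
  ultimately have P: "P \<le> 770 * e" "P \<le> 1" by linarith+
  have P0: "0 \<le> P" unfolding P_def by (intro add_nonneg_nonneg) auto
  define y where "y = 6 / L"
  have y: "0 < y" "y \<le> 1 / 2" using L by (auto simp: y_def field_simps)
  have Dle: "D \<le> d * (1 + y)"
  proof -
    have "6 * h \<le> d * y" using d L unfolding y_def h_def[symmetric] by (simp add: field_simps)
    then show ?thesis by (simp add: D_def distrib_left)
  qed
  have D0: "D > 0" using d0 h by (simp add: D_def)
  have main: "(\<gamma> / d)\<^sup>2 * ((1 - 4 * e) * (1 - 2 * y)) \<le> ((1 - 2 * e) * \<gamma> / D)\<^sup>2"
  proof -
    have "(1 - 4 * e) * (1 - 2 * y) \<le> (1 - 2 * e)\<^sup>2 * (1 / (1 + y))\<^sup>2"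
    proof (intro mult_mono)
      show "1 - 4 * e \<le> (1 - 2 * e)\<^sup>2" by (simp add: power2_eq_square algebra_simps)
      have "1 - y \<le> 1 / (1 + y)" using y by (simp add: field_simps)
      then have "(1 - y)\<^sup>2 \<le> (1 / (1 + y))\<^sup>2" using y by (intro power_mono) auto
      moreover have "1 - 2 * y \<le> (1 - y)\<^sup>2" by (simp add: power2_eq_square algebra_simps)
      ultimately show "1 - 2 * y \<le> (1 / (1 + y))\<^sup>2" by linarith
    qed (use e y in auto)
    then have "(\<gamma> / d)\<^sup>2 * ((1 - 4 * e) * (1 - 2 * y)) \<le> (\<gamma> / d)\<^sup>2 * ((1 - 2 * e)\<^sup>2 * (1 / (1 + y))\<^sup>2)"
      by (intro mult_left_mono) auto
    also have "\<dots> = ((1 - 2 * e) * \<gamma> / (d * (1 + y)))\<^sup>2"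
      by (simp add: power_mult_distrib power_divide)
    also have "\<dots> \<le> ((1 - 2 * e) * \<gamma> / D)\<^sup>2"
      using e g2 D0 Dle y d0 by (intro power_mono divide_left_mono) auto
    finally show ?thesis .
  qed
  \<comment> \<open>First-order losses add up: 4 e, then 2 y = 12 / L, then P \<le> 770 e.\<close>
  have "1 - (774 * e + 12 / L) \<le> (1 - 4 * e) * (1 - 2 * y) * (1 - P)"
  proof -
    have "1 - 4 * e - 2 * y \<le> (1 - 4 * e) * (1 - 2 * y)"
      using e y by (simp add: algebra_simps)
    then have "(1 - 4 * e - 2 * y) * (1 - P) \<le> (1 - 4 * e) * (1 - 2 * y) * (1 - P)"
      using P by (intro mult_right_mono) auto
    moreover have "1 - 4 * e - 2 * y - P \<le> (1 - 4 * e - 2 * y) * (1 - P)"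
      using P0 e y by (simp add: algebra_simps)
    ultimately show ?thesis using P by (simp add: y_def)
  qed
  then have "(\<gamma> / d)\<^sup>2 * (1 - (774 * e + 12 / L)) \<le> (\<gamma> / d)\<^sup>2 * ((1 - 4 * e) * (1 - 2 * y) * (1 - P))"
    by (intro mult_left_mono) auto
  also have "\<dots> = (\<gamma> / d)\<^sup>2 * ((1 - 4 * e) * (1 - 2 * y)) * (1 - P)" by simp
  also have "\<dots> \<le> ((1 - 2 * e) * \<gamma> / D)\<^sup>2 * (1 - P)"
    using main P by (intro mult_right_mono) auto
  finally show ?thesis using bound by linarith
qed

end

text \<open>A relative error uniform in \<open>a\<close> survives weighting and summation, so the
  number of arms does not enter the bound.\<close>

lemma weighted_ratio_bound:
  fixes w x y :: "'a \<Rightarrow> real"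
  assumes A: "finite A" "A \<noteq> {}" and pos: "\<And>a. a \<in> A \<Longrightarrow> 0 < w a * y a" "\<And>a. a \<in> A \<Longrightarrow> 0 < w a"
    and B: "\<And>a. a \<in> A \<Longrightarrow> \<bar>x a - y a\<bar> \<le> B * y a"
  shows "\<bar>(\<Sum>a\<in>A. w a * x a) / (\<Sum>a\<in>A. w a * y a) - 1\<bar> \<le> B"
proof -
  let ?x = "\<Sum>a\<in>A. w a * x a" and ?y = "\<Sum>a\<in>A. w a * y a"
  have y: "?y > 0" by (rule sum_pos[OF A pos(1)])
  have "\<bar>?x - ?y\<bar> = \<bar>\<Sum>a\<in>A. w a * (x a - y a)\<bar>" by (simp add: sum_subtractf right_diff_distrib)
  also have "\<dots> \<le> (\<Sum>a\<in>A. w a * (B * y a))"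
  proof (rule order_trans[OF sum_abs], intro sum_mono)
    fix a assume a: "a \<in> A"
    show "\<bar>w a * (x a - y a)\<bar> \<le> w a * (B * y a)"
      unfolding abs_mult using pos(2)[OF a] B[OF a] by (simp add: mult_left_mono)
  qed
  also have "\<dots> = B * ?y" by (simp add: sum_distrib_left ac_simps)
  finally have "\<bar>?x - ?y\<bar> \<le> B * ?y" .
  moreover have "?x / ?y - 1 = (?x - ?y) / ?y" using y by (simp add: diff_divide_distrib)
  ultimately show ?thesis using y by (simp add: abs_divide divide_le_eq)
qed

section \<open>From pull counts to the regret ratio\<close>

lemma gap_of_gaps:
  assumes "\<And>b. b \<in> {1..K} \<Longrightarrow> \<Delta> b \<ge> 0" and "b \<in> {1..K}" "\<Delta> b = 0"
  shows "gap K (\<lambda>a. m - \<Delta> a) a = \<Delta> a"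
proof -
  have "Max ((\<lambda>a. m - \<Delta> a) ` {1..K}) = m"
  proof (rule Max_eqI)
    show "m \<in> (\<lambda>a. m - \<Delta> a) ` {1..K}" using assms(2,3) by (intro image_eqI[of _ _ b]) auto
  qed (use assms(1) in auto)
  then show ?thesis by (simp add: gap_def)
qed

lemma (in ucb) regret_eq:
  assumes "\<And>b. b \<in> {1..K} \<Longrightarrow> \<Delta> b \<ge> 0" and "b \<in> {1..K}" "\<Delta> b = 0"
  shows "regret T K (\<lambda>a. m - \<Delta> a) \<sigma> \<pi>
    = (\<Sum>a | a \<in> {1..K} \<and> \<Delta> a > 0. \<Delta> a * expectation (\<lambda>\<xi>. real (npulls \<xi> a T)))"
proof -
  have "gap K (\<lambda>a. m - \<Delta> a) a = \<Delta> a" for a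
    by (rule gap_of_gaps[of K \<Delta> b]) (use assms in auto)
  then show ?thesis unfolding regret_def npulls_eq_pulls rew_def by simp
qed

lemma gap_classD:
  assumes "\<Delta> \<in> gap_class T K \<sigma> \<eta> L"
  shows "\<And>b. b \<in> {1..K} \<Longrightarrow> \<Delta> b \<ge> 0" and "\<exists>b\<in>{1..K}. \<Delta> b = 0"
    and "\<And>a. a \<in> {1..K} \<Longrightarrow> \<Delta> a > 0 \<Longrightarrow> L * sqrt (real K * ln (real T) / real T) \<le> \<Delta> a / \<sigma>"
    and "\<And>a. a \<in> {1..K} \<Longrightarrow> \<Delta> a > 0 \<Longrightarrow> \<Delta> a / \<sigma> \<le> \<eta> * sqrt (ln (real T))"
proof -
  note * = assms[unfolded gap_class_def, THEN CollectD]
  note 1 = *[THEN conjunct1] and 2 = *[THEN conjunct2, THEN conjunct1] and 3 = *[THEN conjunct2, THEN conjunct2]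
  show "\<Delta> b \<ge> 0" if "b \<in> {1..K}" for b using PiE_mem[OF 1 that] by simp
  show "\<exists>b\<in>{1..K}. \<Delta> b = 0" using 2 by blast
  have "\<Delta> a / \<sigma> \<in> {L * sqrt (real K * ln (real T) / real T) .. \<eta> * sqrt (ln (real T))}"
    if "a \<in> {1..K}" "\<Delta> a > 0" for a
    by (rule subsetD[OF 3]) (use that in blast)
  then show "\<And>a. a \<in> {1..K} \<Longrightarrow> \<Delta> a > 0 \<Longrightarrow> L * sqrt (real K * ln (real T) / real T) \<le> \<Delta> a / \<sigma>"
    and "\<And>a. a \<in> {1..K} \<Longrightarrow> \<Delta> a > 0 \<Longrightarrow> \<Delta> a / \<sigma> \<le> \<eta> * sqrt (ln (real T))" by auto
qed

lemma gap_class_nz_pos: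
  assumes "\<Delta> \<in> gap_class_nz T K \<sigma> \<eta> L"
  shows "\<exists>a\<in>{1..K}. \<Delta> a > 0"
proof -
  have "\<Delta> \<in> gap_class T K \<sigma> \<eta> L" and "\<exists>a\<in>{1..K}. \<Delta> a \<noteq> 0"
    using assms by (auto simp: gap_class_nz_def)
  then obtain a where "a \<in> {1..K}" "\<Delta> a \<noteq> 0" "\<Delta> a \<ge> 0" using gap_classD(1) by blast
  then show ?thesis by (intro bexI[of _ a]) auto
qed

text \<open>Both regrets are sums over the same arms with weights \<Delta>, of the expected counts
  and of the Lai-Robbins counts, so the armwise two-sided bounds transfer by
  \<open>weighted_ratio_bound\<close>.\<close>

lemma regret_ratio_deviation:
  fixes T K :: nat and \<eta> L :: real
  defines "l \<equiv> ln (real T)" and "e \<equiv> sqrt (ln (ln (real T)) / ln (real T))"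
  assumes l: "1024 \<le> l" and KT: "2 * K \<le> T" and K: "1 \<le> K" and \<sigma>: "\<sigma> > 0" and L: "12 \<le> L"
    and ucb: "is_ucb1 T K \<sigma> (sqrt (2 * l)) \<pi>" and \<Delta>: "\<Delta> \<in> gap_class_nz T K \<sigma> \<eta> L"
  shows "\<bar>regret_ratio T K m \<Delta> \<sigma> \<pi> - 1\<bar> \<le> 774 * e + 12 / L + \<eta>\<^sup>2"
proof -
  interpret ucb T K \<sigma> "sqrt (2 * l)" m \<Delta> \<pi>
    using KT \<sigma> ucb by unfold_locales auto
  have e: "e > 0" using ln_ratio_bounds(2)[OF l] by (simp add: e_def l_def)
  have cl: "\<Delta> \<in> gap_class T K \<sigma> \<eta> L" using \<Delta> by (simp add: gap_class_nz_def)
  note D = gap_classD[OF cl, folded l_def]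
  obtain b where b: "b \<in> {1..K}" "\<Delta> b = 0" using D(2) by blast
  have nn: "\<And>b. b \<in> {1..K} \<Longrightarrow> \<Delta> b \<ge> 0" by (rule D(1))
  define A where "A = {a. a \<in> {1..K} \<and> \<Delta> a > 0}"
  define x where "x a = expectation (\<lambda>\<xi>. real (npulls \<xi> a T))" for a
  define y where "y a = (sqrt (2 * l) / (\<Delta> a / \<sigma>))\<^sup>2" for a
  have ratio: "regret_ratio T K m \<Delta> \<sigma> \<pi> = (\<Sum>a\<in>A. \<Delta> a * x a) / (\<Sum>a\<in>A. \<Delta> a * y a)"
  proof -
    have "2 * l * (\<Sum>a\<in>A. \<sigma>\<^sup>2 / \<Delta> a) = (\<Sum>a\<in>A. \<Delta> a * y a)"
      unfolding sum_distrib_left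
    proof (intro sum.cong refl)
      fix a assume "a \<in> A"
      then have "\<Delta> a > 0" by (simp add: A_def)
      then show "2 * l * (\<sigma>\<^sup>2 / \<Delta> a) = \<Delta> a * y a"
        using l by (simp add: y_def power_divide power2_eq_square)
    qed
    moreover have "regret T K (\<lambda>a. m - \<Delta> a) \<sigma> \<pi> = (\<Sum>a\<in>A. \<Delta> a * x a)"
      unfolding A_def x_def using nn b by (rule regret_eq)
    ultimately show ?thesis
      unfolding regret_ratio_def regret_LR_def l_def[symmetric] A_def[symmetric] by simp
  qed
  show ?thesis unfolding ratio
  proof (rule weighted_ratio_bound)
    show "finite A" by (simp add: A_def)
    show "A \<noteq> {}" using gap_class_nz_pos[OF \<Delta>] by (auto simp: A_def)
  next
    fix a assume "a \<in> A"
    then have a: "a \<in> {1..K}" "\<Delta> a > 0" by (auto simp: A_def)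
    have d: "\<Delta> a / \<sigma> > 0" using a \<sigma> by simp
    have y: "y a > 0" unfolding y_def using a \<sigma> l by (intro zero_less_power divide_pos_pos) auto
    show "0 < \<Delta> a" by (rule a(2))
    show "0 < \<Delta> a * y a" using a y by simp
    have "x a \<le> y a * (1 + 14 * e + \<eta>\<^sup>2)"
      unfolding x_def y_def
      by (rule expectation_npulls_upper[folded e_def, folded l_def, OF l _ refl a(1) b refl d D(4)[OF a]])
        (use KT K in simp)
    moreover have "y a * (1 - (774 * e + 12 / L)) \<le> x a"
      unfolding x_def y_def
      by (rule expectation_npulls_lower[folded e_def, folded l_def, OF l KT refl a(1) _ refl D(3)[OF a] L])
        (rule nn)
    moreover have "14 * e * y a \<le> 774 * e * y a" "0 \<le> 12 / L * y a" "0 \<le> \<eta>\<^sup>2 * y a"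
      using e y L by auto
    ultimately show "\<bar>x a - y a\<bar> \<le> (774 * e + 12 / L + \<eta>\<^sup>2) * y a"
      by (simp add: abs_le_iff algebra_simps)
  qed
qed

section \<open>Small gaps and the infimum\<close>

lemma regret_le:
  assumes "K \<le> T" "\<sigma> > 0" "is_ucb1 T K \<sigma> \<gamma> \<pi>"
    and nn: "\<And>b. b \<in> {1..K} \<Longrightarrow> \<Delta> b \<ge> 0" and b: "b \<in> {1..K}" "\<Delta> b = 0"
    and g: "\<And>a. a \<in> {1..K} \<Longrightarrow> \<Delta> a \<le> g"
  shows "regret T K (\<lambda>a. m - \<Delta> a) \<sigma> \<pi> \<le> g * real T"
proof -
  interpret ucb T K \<sigma> \<gamma> m \<Delta> \<pi> using assms by unfold_locales auto
  have "g \<ge> 0" using g[OF b(1)] b by simp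
  have "regret T K (\<lambda>a. m - \<Delta> a) \<sigma> \<pi>
    = (\<Sum>a | a \<in> {1..K} \<and> \<Delta> a > 0. \<Delta> a * expectation (\<lambda>\<xi>. real (npulls \<xi> a T)))"
    using nn b by (rule regret_eq)
  also have "\<dots> \<le> (\<Sum>a\<in>{1..K}. \<Delta> a * expectation (\<lambda>\<xi>. real (npulls \<xi> a T)))"
    using nn by (intro sum_mono2 mult_nonneg_nonneg integral_nonneg) auto
  also have "\<dots> \<le> (\<Sum>a\<in>{1..K}. g * expectation (\<lambda>\<xi>. real (npulls \<xi> a T)))"
    using g by (intro sum_mono mult_right_mono integral_nonneg) auto
  also have "\<dots> = g * expectation (\<lambda>\<xi>. \<Sum>a\<in>{1..K}. real (npulls \<xi> a T))"
    by (simp add: sum_distrib_left Bochner_Integration.integral_sum npulls_integrable)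
  also have "(\<lambda>\<xi>. \<Sum>a\<in>{1..K}. real (npulls \<xi> a T)) = (\<lambda>_. real T)"
    using sum_npulls[of T] by (simp flip: of_nat_sum)
  finally show ?thesis by (simp add: prob_space)
qed

lemma regret_ratio_zero:
  assumes "1 \<le> K"
  shows "regret_ratio T K m (\<lambda>a\<in>{1..K}. 0) \<sigma> \<pi> = 0"
proof -
  let ?z = "\<lambda>a\<in>{1..K}. 0 :: real"
  have g: "gap K (\<lambda>a. m - ?z a) a = ?z a" for a
    by (rule gap_of_gaps[of K ?z 1]) (use assms in auto)
  have "{a. a \<in> {1..K} \<and> ?z a > 0} = {}" by auto
  then show ?thesis unfolding regret_ratio_def regret_def regret_LR_def g by simp
qed

text \<open>The interval constraint concerns positive gaps and is vacuous here; K \<ge> 1 makes the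
  empty support a proper subset.\<close>

lemma zero_in_gap_class:
  assumes "1 \<le> K"
  shows "(\<lambda>a\<in>{1..K}. 0) \<in> gap_class T K \<sigma> \<eta> L"
proof -
  define z where "z = (\<lambda>a\<in>{1..K}. 0 :: real)"
  have z: "z a = 0" if "a \<in> {1..K}" for a using that by (simp add: z_def)
  have "{a\<in>{1..K}. z a \<noteq> 0} \<subset> {1..K}" using z[of 1] assms by force
  moreover have "{z a / \<sigma> | a. a \<in> {1..K} \<and> z a > 0} = {}" using z by force
  moreover have "z \<in> {1..K} \<rightarrow>\<^sub>E {0..}" unfolding z_def by (rule restrict_PiE_iff[THEN iffD2]) simp
  ultimately have "z \<in> gap_class T K \<sigma> \<eta> L" unfolding gap_class_def by blast
  then show ?thesis unfolding z_def .
qed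

text \<open>If arms 2 to K all have gap \<open>g\<close>, the trivial regret bound g T gives a ratio
  of at most g^2 T / (2 \<sigma>^2 (K - 1) ln T), that is \<epsilon>^2 K / (2 (K - 1)). Since K
  \<ge> 2 this is at most \<epsilon>^2.\<close>

lemma small_gap_witness:
  fixes \<epsilon> :: real
  assumes T: "ln (real T) > 0" and KT: "K \<le> T" and \<sigma>: "\<sigma> > 0" and \<epsilon>: "\<epsilon> > 0"
    and ucb: "is_ucb1 T K \<sigma> \<gamma> \<pi>" and ne: "gap_class_nz T K \<sigma> \<eta> \<epsilon> \<noteq> {}"
  shows "\<exists>\<Delta>\<in>gap_class_nz T K \<sigma> \<eta> \<epsilon>. regret_ratio T K m \<Delta> \<sigma> \<pi> \<le> \<epsilon>\<^sup>2"
proof -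
  obtain \<Delta>0 where D0: "\<Delta>0 \<in> gap_class_nz T K \<sigma> \<eta> \<epsilon>" using ne by blast
  then have cl: "\<Delta>0 \<in> gap_class T K \<sigma> \<eta> \<epsilon>" by (simp add: gap_class_nz_def)
  obtain a where a: "a \<in> {1..K}" "\<Delta>0 a > 0" using gap_class_nz_pos[OF D0] by blast
  obtain b where b: "b \<in> {1..K}" "\<Delta>0 b = 0" using gap_classD(2)[OF cl] by blast
  define h where "h = sqrt (real K * ln (real T) / real T)"
  define g where "g = \<sigma> * (\<epsilon> * h)"
  have "a \<noteq> b" using a b by auto
  then have K: "2 \<le> K" using a b by auto
  have h: "h > 0" "h\<^sup>2 = real K * ln (real T) / real T" using K KT T by (auto simp: h_def)
  have g: "g > 0" using \<sigma> \<epsilon> h by (simp add: g_def)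
  \<comment> \<open>Any member of the class has a scaled gap between the two endpoints, so the
    interval is nonempty and its left endpoint is admissible.\<close>
  have le: "\<epsilon> * h \<le> \<eta> * sqrt (ln (real T))"
    using gap_classD(3,4)[OF cl a] by (simp add: h_def)
  define \<Delta> where "\<Delta> = (\<lambda>a\<in>{1..K}. if a = 1 then 0 else g)"
  have one: "1 \<in> {1..K}" "\<Delta> 1 = 0" and two: "2 \<in> {1..K}" "\<Delta> 2 = g" using K by (auto simp: \<Delta>_def)
  have "{a\<in>{1..K}. \<Delta> a \<noteq> 0} \<subset> {1..K}" using one by blast
  moreover have "\<Delta> \<in> {1..K} \<rightarrow>\<^sub>E {0..}" using g by (auto simp: \<Delta>_def)
  moreover have "\<Delta> a / \<sigma> \<in> {\<epsilon> * h .. \<eta> * sqrt (ln (real T))}" if "a \<in> {1..K}" "\<Delta> a > 0" for a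
    using that le \<sigma> by (auto simp: \<Delta>_def g_def split: if_splits)
  ultimately have "\<Delta> \<in> gap_class T K \<sigma> \<eta> \<epsilon>" unfolding gap_class_def h_def by blast
  moreover have "\<exists>a\<in>{1..K}. \<Delta> a \<noteq> 0" using two g by (intro bexI[of _ 2]) auto
  ultimately have mem: "\<Delta> \<in> gap_class_nz T K \<sigma> \<eta> \<epsilon>"
    unfolding gap_class_nz_def by blast
  have supp: "{a. a \<in> {1..K} \<and> \<Delta> a > 0} = {2..K}" using g by (auto simp: \<Delta>_def)
  have LR: "regret_LR T K \<Delta> \<sigma> = 2 * ln (real T) * (real (K - 1) * (\<sigma>\<^sup>2 / g))"
  proof -
    have "(\<Sum>a\<in>{2..K}. \<sigma>\<^sup>2 / \<Delta> a) = (\<Sum>a\<in>{2..K}. \<sigma>\<^sup>2 / g)"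
      by (intro sum.cong) (auto simp: \<Delta>_def)
    then show ?thesis unfolding regret_LR_def supp by simp
  qed
  have LRpos: "regret_LR T K \<Delta> \<sigma> > 0" unfolding LR using T K \<sigma> g by simp
  have "regret T K (\<lambda>a. m - \<Delta> a) \<sigma> \<pi> \<le> g * real T"
    by (rule regret_le[of K T \<sigma> \<gamma> \<pi> \<Delta> 1])
      (use KT \<sigma> ucb one g in \<open>auto simp: \<Delta>_def\<close>)
  also have "\<dots> \<le> \<epsilon>\<^sup>2 * regret_LR T K \<Delta> \<sigma>"
  proof -
    have "g\<^sup>2 * real T = \<sigma>\<^sup>2 * \<epsilon>\<^sup>2 * (real K * ln (real T))"
      using K KT by (simp add: g_def power_mult_distrib h)
    also have "\<dots> \<le> \<sigma>\<^sup>2 * \<epsilon>\<^sup>2 * (2 * real (K - 1) * ln (real T))"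
      using K T by (intro mult_left_mono mult_right_mono) (auto simp: of_nat_diff)
    finally have "g * real T * g \<le> \<epsilon>\<^sup>2 * (2 * ln (real T) * (real (K - 1) * \<sigma>\<^sup>2))"
      by (simp add: power2_eq_square ac_simps)
    then have "g * real T \<le> \<epsilon>\<^sup>2 * (2 * ln (real T) * (real (K - 1) * \<sigma>\<^sup>2)) / g"
      using g by (simp add: pos_le_divide_eq)
    then show ?thesis unfolding LR by simp
  qed
  finally have "regret_ratio T K m \<Delta> \<sigma> \<pi> \<le> \<epsilon>\<^sup>2"
    unfolding regret_ratio_def using LRpos by (simp add: pos_divide_le_eq)
  with mem show ?thesis by blast
qed

text \<open>The constant depends on \<open>\<eta>max\<close> alone. In the extended reals an empty
  infimum is plus infinity, hence the nonemptiness premise of the last clause; an empty supremum is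
  minus infinity.\<close>

theorem corollary3p4:
  fixes \<eta>max :: real
  assumes "\<eta>max > 0"
  shows "\<exists>C::real. C > 0 \<and>
    (\<forall>(T::nat) (K::nat) (\<sigma>::real) (\<eta>::real) (m::real) (\<pi>::policy).
       3 \<le> T \<and> 1 \<le> K \<and> K \<le> T \<and> \<sigma> > 0 \<and> \<eta> > 0 \<and>
       is_ucb1 T K \<sigma> (sqrt (2 * ln (real T))) \<pi> \<and> real K / real T \<le> 1 / C \<longrightarrow>
       (\<eta> \<le> \<eta>max \<longrightarrow>
         (\<forall>L::real. L > C \<longrightarrow>
           (SUP \<Delta> \<in> gap_class_nz T K \<sigma> \<eta> L. ereal \<bar>regret_ratio T K m \<Delta> \<sigma> \<pi> - 1\<bar>)
             \<le> ereal (C * (1 / L + eps_TK T K + \<eta>)))) \<and>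
       (\<forall>\<epsilon>::real. 0 < \<epsilon> \<and> \<epsilon> < 1 / 2 \<longrightarrow>
         (INF \<Delta> \<in> gap_class T K \<sigma> \<eta> \<epsilon>. ereal (regret_ratio T K m \<Delta> \<sigma> \<pi>)) \<le> ereal (C * \<epsilon>\<^sup>2) \<and>
         (gap_class_nz T K \<sigma> \<eta> \<epsilon> \<noteq> {} \<longrightarrow>
           (INF \<Delta> \<in> gap_class_nz T K \<sigma> \<eta> \<epsilon>. ereal (regret_ratio T K m \<Delta> \<sigma> \<pi>))
             \<le> ereal (C * \<epsilon>\<^sup>2))))"
proof -
  \<comment> \<open>With K \<ge> 1, the condition K / T \<le> 1 / C forces T \<ge> exp 1024, the
    threshold of the estimates. The same summand dominates 12 and 774, while
    \<open>\<eta>max\<close> turns \<eta>^2 into C \<eta>.\<close>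
  define C :: real where "C = exp 1024 + \<eta>max"
  have C: "exp 1024 \<le> C" "1025 \<le> C" "\<eta>max \<le> C"
    using assms exp_ge_add_one_self[of 1024] by (auto simp: C_def simp del: exp_ge_add_one_self)
  have part1: "(SUP \<Delta> \<in> gap_class_nz T K \<sigma> \<eta> L. ereal \<bar>regret_ratio T K m \<Delta> \<sigma> \<pi> - 1\<bar>)
             \<le> ereal (C * (1 / L + eps_TK T K + \<eta>))"
    if l: "1024 \<le> ln (real T)" and KT: "2 * K \<le> T" and K: "1 \<le> K" and \<sigma>: "\<sigma> > 0"
      and \<eta>: "0 < \<eta>" "\<eta> \<le> \<eta>max" and ucb: "is_ucb1 T K \<sigma> (sqrt (2 * ln (real T))) \<pi>" and L: "L > C"
    for T K \<sigma> \<eta> m \<pi> L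
  proof (rule SUP_least)
    fix \<Delta> assume \<Delta>: "\<Delta> \<in> gap_class_nz T K \<sigma> \<eta> L"
    define e where "e = sqrt (ln (ln (real T)) / ln (real T))"
    have L12: "12 \<le> L" using L C by simp
    have e: "0 < e" using ln_ratio_bounds(2)[OF l] by (simp add: e_def)
    have "\<bar>regret_ratio T K m \<Delta> \<sigma> \<pi> - 1\<bar> \<le> 774 * e + 12 / L + \<eta>\<^sup>2"
      unfolding e_def by (rule regret_ratio_deviation[OF l KT K \<sigma> L12 ucb \<Delta>])
    also have "\<dots> \<le> C * e + C * (1 / L) + C * \<eta>"
    proof (intro add_mono)
      show "774 * e \<le> C * e" using C e by (intro mult_right_mono) auto
      have "12 * (1 / L) \<le> C * (1 / L)" using C L12 by (intro mult_right_mono) auto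
      then show "12 / L \<le> C * (1 / L)" by simp
      show "\<eta>\<^sup>2 \<le> C * \<eta>" unfolding power2_eq_square using \<eta> C by (intro mult_right_mono) auto
    qed
    also have "\<dots> \<le> C * (1 / L + eps_TK T K + \<eta>)"
    proof -
      have "0 \<le> C * (real K / real T)" using C by (intro mult_nonneg_nonneg) auto
      then show ?thesis unfolding eps_TK_def e_def[symmetric] by (simp add: distrib_left)
    qed
    finally show "ereal \<bar>regret_ratio T K m \<Delta> \<sigma> \<pi> - 1\<bar> \<le> ereal (C * (1 / L + eps_TK T K + \<eta>))"
      by simp
  qed
  \<comment> \<open>The zero vector belongs to this class and has ratio 0 / 0 = 0;
    \<open>part3\<close> gives the bound over nonzero gap vectors.\<close>
  have part2: "(INF \<Delta> \<in> gap_class T K \<sigma> \<eta> \<epsilon>. ereal (regret_ratio T K m \<Delta> \<sigma> \<pi>)) \<le> ereal (C * \<epsilon>\<^sup>2)"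
    if "1 \<le> K" for T K \<sigma> \<eta> m \<pi> \<epsilon>
    by (rule INF_lower2[OF zero_in_gap_class[OF that]], subst regret_ratio_zero[OF that])
       (use C in simp)
  have part3: "(INF \<Delta> \<in> gap_class_nz T K \<sigma> \<eta> \<epsilon>. ereal (regret_ratio T K m \<Delta> \<sigma> \<pi>)) \<le> ereal (C * \<epsilon>\<^sup>2)"
    if "0 < ln (real T)" "K \<le> T" "\<sigma> > 0" "0 < \<epsilon>" "is_ucb1 T K \<sigma> (sqrt (2 * ln (real T))) \<pi>"
      "gap_class_nz T K \<sigma> \<eta> \<epsilon> \<noteq> {}" for T K \<sigma> \<eta> m \<pi> \<epsilon>
  proof -
    note prems = that
    obtain \<Delta> where "\<Delta> \<in> gap_class_nz T K \<sigma> \<eta> \<epsilon>" "regret_ratio T K m \<Delta> \<sigma> \<pi> \<le> \<epsilon>\<^sup>2"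
      using small_gap_witness[OF prems] by blast
    moreover have "1 * \<epsilon>\<^sup>2 \<le> C * \<epsilon>\<^sup>2" using C by (intro mult_right_mono) auto
    ultimately show ?thesis by (intro INF_lower2) auto
  qed
  have large: "1024 \<le> ln (real T)" "2 * K \<le> T" if "1 \<le> K" "K \<le> T" "real K / real T \<le> 1 / C" for T K
  proof -
    have CK: "C * real K \<le> real T" using that C by (simp add: field_simps)
    have "C * 1 \<le> C * real K" using that C by (intro mult_left_mono) auto
    then have "exp 1024 \<le> real T" using CK C by linarith
    then show "1024 \<le> ln (real T)" using that by (subst ln_ge_iff) auto
    have "2 * real K \<le> C * real K" using C by (intro mult_right_mono) auto
    then have "real (2 * K) \<le> real T" using CK by simp
    then show "2 * K \<le> T" by (simp only: of_nat_le_iff)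
  qed
  show ?thesis
  proof (intro exI[of _ C] conjI allI impI; (elim conjE)?)
    show "C > 0" using C by simp
  next
    fix T K :: nat and \<sigma> \<eta> m L :: real and \<pi> :: policy
    assume *: "1 \<le> K" "K \<le> T" "\<sigma> > 0" "\<eta> > 0" "is_ucb1 T K \<sigma> (sqrt (2 * ln (real T))) \<pi>"
      "real K / real T \<le> 1 / C" "\<eta> \<le> \<eta>max" "L > C"
    show "(SUP \<Delta> \<in> gap_class_nz T K \<sigma> \<eta> L. ereal \<bar>regret_ratio T K m \<Delta> \<sigma> \<pi> - 1\<bar>)
             \<le> ereal (C * (1 / L + eps_TK T K + \<eta>))"
      by (rule part1[OF large[OF *(1,2,6)]]) (use * in auto)
  next
    fix T K :: nat and \<sigma> \<eta> m \<epsilon> :: real and \<pi> :: policy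
    assume "1 \<le> K"
    then show "(INF \<Delta> \<in> gap_class T K \<sigma> \<eta> \<epsilon>. ereal (regret_ratio T K m \<Delta> \<sigma> \<pi>)) \<le> ereal (C * \<epsilon>\<^sup>2)"
      by (rule part2)
  next
    fix T K :: nat and \<sigma> \<eta> m \<epsilon> :: real and \<pi> :: policy
    assume *: "3 \<le> T" "K \<le> T" "\<sigma> > 0" "is_ucb1 T K \<sigma> (sqrt (2 * ln (real T))) \<pi>"
      "0 < \<epsilon>" "gap_class_nz T K \<sigma> \<eta> \<epsilon> \<noteq> {}"
    show "(INF \<Delta> \<in> gap_class_nz T K \<sigma> \<eta> \<epsilon>. ereal (regret_ratio T K m \<Delta> \<sigma> \<pi>)) \<le> ereal (C * \<epsilon>\<^sup>2)"
      by (rule part3) (use * in auto)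
  qed
qed

end
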